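(* The $n$th order rate distortion function with feed-forward $$R_n(D)=\frac1n\min_{p(\hat x^n|x^n):\ \mathbb E[d(X^n,\hat X^n)]\le D} I(\hat X^n\to X^n)$$ can be written (in geometric programming standard form) as the maximization problem $$R_n(D)=\max_{\lambda,\ \gamma(x^n),\ \{p'(x_i|x^{i-1},\hat x^{i})\}_{i=1}^n}\ \frac1n\Big(-\lambda D+\sum_{x^n}p(x^n)\log\gamma(x^n)\Big)$$ subject to the constraints $$\log p(x^n)+\log\gamma(x^n)-\lambda d(x^n,\hat x^n)-\sum_{i=1}^n\log p'(x_i|x^{i-1},\hat x^i)\le 0\quad\text{for all }x^n,\hat x^n,$$ $$\sum_{x_i}p'(x_i|x^{i-1},\hat x^i)=1\quad\text{for all }i\text{ and all }x^{i-1},\hat x^{i},$$ $$\lambda\ge 0.$$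
   Context: $\mathcal X,\hat{\mathcal X}$ are finite alphabets, $n\ge1$, $x^n=(x_1,\dots,x_n)\in\mathcal X^n$, $\hat x^n\in\hat{\mathcal X}^n$; logarithms are base 2. $p(x^n)$ is a fixed pmf of the source block $X^n$ and $d:\mathcal X^n\times\hat{\mathcal X}^n\to[0,\infty)$ is a bounded distortion function. Directed information under the joint law $p(x^n)p(\hat x^n|x^n)$: $I(\hat X^n\to X^n)=\sum_{i=1}^n I(\hat X^i;X_i|X^{i-1})$. The minimum defining $R_n(D)$ is over all conditional pmfs $p(\hat x^n|x^n)$ satisfying the distortion constraint. In the maximization, $\lambda$ is a real number, $\gamma$ is a positive function on $\mathcal X^n$, and $p'(x_i|x^{i-1},\hat x^i)\ge0$ are real variables (one for each $i$, $x^i$, $\hat x^i$).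
   Formalization: D must be achievable (the min is over a nonempty set); at the smallest achievable D the max is replaced by a supremum, since it need not be attained (n=1, uniform binary source, Hamming distortion, D=0); for larger D the max is attained. *)

theory Defs
  imports "HOL-Probability.Probability"
begin

text \<open>
  The alphabets are finite types \<open>'x\<close> (source) and \<open>'y\<close> (reproduction); reproduction blocks,
  often written with a hat over \<open>X\<close>, \<open>x\<close>, are called \<open>Y\<close>, \<open>y\<close> here.  A block of length \<open>n\<close> is a
  list; the prefix \<open>x\<^sup>i\<close> is \<open>take i x\<close> and, as lists are indexed from 0, the letter \<open>x\<^sub>i\<close>
  (for \<open>1 \<le> i \<le> n\<close>) is \<open>x ! (i - 1)\<close>.
\<close>

definition blocks :: "nat \<Rightarrow> 'a list set" where
  "blocks n = {xs. length xs = n}"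

text \<open>Only the values of a channel on blocks of length \<open>n\<close> matter below.\<close>

definition channels :: "nat \<Rightarrow> ('x list \<Rightarrow> 'y list pmf) set" where
  "channels n = {W. \<forall>x\<in>blocks n. set_pmf (W x) \<subseteq> blocks n}"

definition joint_pmf :: "'x list pmf \<Rightarrow> ('x list \<Rightarrow> 'y list pmf) \<Rightarrow> ('x list \<times> 'y list) pmf" where
  "joint_pmf P W = bind_pmf P (\<lambda>x. map_pmf (Pair x) (W x))"

text \<open>
  Conditional mutual information \<open>I(X; Y | Z)\<close> in bits, for random variables with finite range on a
  discrete probability space; this is the library's \<open>\<I>(X ; Y | Z)\<close> in base 2.
\<close>

definition cond_mutual_info ::
    "'w pmf \<Rightarrow> ('w \<Rightarrow> 'a) \<Rightarrow> ('w \<Rightarrow> 'b) \<Rightarrow> ('w \<Rightarrow> 'c) \<Rightarrow> real" where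
  "cond_mutual_info J X Y Z =
     prob_space.conditional_mutual_information (measure_pmf J) 2
       (count_space (range X)) (count_space (range Y)) (count_space (range Z)) X Y Z"

text \<open>\<open>I(Y\<^sup>n \<rightarrow> X\<^sup>n)\<close>: the direction is from the reproduction to the source.\<close>

definition directed_info ::
    "nat \<Rightarrow> 'x::finite list pmf \<Rightarrow> ('x list \<Rightarrow> 'y::finite list pmf) \<Rightarrow> real" where
  "directed_info n P W =
     (\<Sum>i=1..n. cond_mutual_info (joint_pmf P W)
        (\<lambda>(x, y). take i y) (\<lambda>(x, y). x ! (i - 1)) (\<lambda>(x, y). take (i - 1) x))"

definition expected_distortion ::
    "'x list pmf \<Rightarrow> ('x list \<Rightarrow> 'y list \<Rightarrow> real) \<Rightarrow> ('x list \<Rightarrow> 'y list pmf) \<Rightarrow> real" where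
  "expected_distortion P d W = measure_pmf.expectation (joint_pmf P W) (\<lambda>(x, y). d x y)"

definition admissible_channels ::
    "nat \<Rightarrow> 'x list pmf \<Rightarrow> ('x list \<Rightarrow> 'y list \<Rightarrow> real) \<Rightarrow> real \<Rightarrow> ('x list \<Rightarrow> 'y list pmf) set" where
  "admissible_channels n P d D = {W \<in> channels n. expected_distortion P d W \<le> D}"

text \<open>Meaningful when some channel is admissible; that the infimum is then a minimum is a claim.\<close>

definition ff_rate_distortion ::
    "nat \<Rightarrow> 'x::finite list pmf \<Rightarrow> ('x list \<Rightarrow> 'y::finite list \<Rightarrow> real) \<Rightarrow> real \<Rightarrow> real" where
  "ff_rate_distortion n P d D =
     (1 / real n) * (INF W\<in>admissible_channels n P d D. directed_info n P W)"

text \<open>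
  Logarithm on \<open>[0, \<infinity>)\<close> with \<open>log 0 = -\<infinity>\<close> (whereas \<open>log 2 0 = 0\<close> for the library's real logarithm).
\<close>

definition elog2 :: "real \<Rightarrow> ereal" where
  "elog2 t = (if 0 < t then ereal (log 2 t) else -\<infinity>)"

text \<open>
  The variable \<open>p'(x\<^sub>i | x\<^bsup>i-1\<^esup>, y\<^sup>i)\<close> is \<open>q i u v a\<close> with \<open>u = x\<^bsup>i-1\<^esup>\<close>, \<open>v = y\<^sup>i\<close>, \<open>a = x\<^sub>i\<close>.
  In the logarithmic constraint the sum of the \<open>log p'\<close> stands on the right-hand side: no undefined
  difference of infinities can then occur.  If \<open>p(x\<^sup>n) = 0\<close> the constraint holds trivially, and if
  \<open>p(x\<^sup>n) > 0\<close> it forces all the \<open>p'\<close> occurring in it to be positive.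
\<close>

definition gp_feasible ::
    "nat \<Rightarrow> 'x::finite list pmf \<Rightarrow> ('x list \<Rightarrow> 'y::finite list \<Rightarrow> real) \<Rightarrow>
     real \<Rightarrow> ('x list \<Rightarrow> real) \<Rightarrow> (nat \<Rightarrow> 'x list \<Rightarrow> 'y list \<Rightarrow> 'x \<Rightarrow> real) \<Rightarrow> bool" where
  "gp_feasible n P d l \<gamma> q \<longleftrightarrow>
     0 \<le> l \<and>
     (\<forall>x\<in>blocks n. 0 < \<gamma> x) \<and>
     (\<forall>i\<in>{1..n}. \<forall>u\<in>blocks (i - 1). \<forall>v\<in>blocks i.
        (\<forall>a. 0 \<le> q i u v a) \<and> (\<Sum>a\<in>UNIV. q i u v a) = 1) \<and>
     (\<forall>x\<in>blocks n. \<forall>y\<in>blocks n.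
        elog2 (pmf P x) + elog2 (\<gamma> x) - ereal (l * d x y)
          \<le> (\<Sum>i=1..n. elog2 (q i (take (i - 1) x) (take i y) (x ! (i - 1)))))"

definition gp_objective ::
    "nat \<Rightarrow> 'x list pmf \<Rightarrow> real \<Rightarrow> real \<Rightarrow> ('x list \<Rightarrow> real) \<Rightarrow> real" where
  "gp_objective n P D l \<gamma> =
     (1 / real n) * (- l * D + (\<Sum>x\<in>blocks n. pmf P x * log 2 (\<gamma> x)))"

end

theory Submission
  imports Defs "HOL-Real_Asymp.Real_Asymp"
begin

text \<open>
  Write a channel as its joint mass function \<open>J\<close> with \<open>P\<close>.  Up to the entropy of \<open>P\<close>, the directed
  information is \<open>\<Sum> J(x, y) * log (\<Prod>\<^sub>i J(x\<^sub>i | x\<^bsup>i-1\<^esup>, y\<^sup>i))\<close>, and by Gibbs' inequality it is the largest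
  value of this sum over all kernels \<open>p'\<close> in place of the conditionals of \<open>J\<close>; weak duality is
  immediate.  For the converse, minimise the directed information plus the penalty
  \<open>\<kappa> * (max 0 (E d - D))\<^sup>2\<close> over the joint laws bounded below by \<open>\<epsilon>\<close> times a uniform one, so that all
  conditionals are positive.  The first-order condition at the minimiser says that its conditionals
  \<open>p'\<close>, the multiplier \<open>\<lambda> = 2 * \<kappa> * max 0 (E d - D)\<close> and the largest \<open>\<gamma>\<close> that they allow are dual feasible with
  almost the primal value.  No convexity of the directed information is needed.
\<close>

subsection \<open>Marginals, causal kernels and Gibbs' inequality\<close>

text \<open>The dual constraint must hold at every pair of blocks, including pairs to which an
  optimal coupling gives no mass. There its conditionals may be \<open>0\<close> or
  \<open>0 / 0\<close>, so the kernel of an unperturbed optimum need not be feasible for any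
  \<open>\<lambda>\<close>; this is what the floor \<open>\<epsilon>\<close> is for. The penalty
  replaces a separation argument: each \<open>\<kappa>\<close> yields a finite multiplier, at most
  \<open>2 * \<kappa> * M\<close> if \<open>d\<close> is bounded by \<open>M\<close>, without any
  constraint qualification. These multipliers may diverge as \<open>\<kappa>\<close> grows, which is
  why the general statement concerns a supremum and strict feasibility is asked for only to obtain a
  maximiser. The two parameters compete: staying above the floor costs up to
  \<open>\<epsilon>\<close> times the multiplier times \<open>M\<close>, so
  \<open>\<epsilon>\<close> has to vanish faster than \<open>1 / \<kappa>\<close>.\<close>

lemma finite_blocks [simp]: "finite (blocks n :: 'a::finite list set)"
  using finite_lists_length_eq[of "UNIV :: 'a set" n] by (simp add: blocks_def)

lemma blocks_nonempty [simp]: "blocks n \<noteq> {}"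
  by (auto simp: blocks_def intro: exI[of _ "replicate n undefined"])

lemma take_in_blocks: "x \<in> blocks n \<Longrightarrow> i \<le> n \<Longrightarrow> take i x \<in> blocks i"
  by (simp add: blocks_def)

lemma take_pred_append_nth:
  "x \<in> blocks n \<Longrightarrow> i \<in> {1..n} \<Longrightarrow> take (i - 1) x @ [x ! (i - 1)] = take i x"
  using take_Suc_conv_app_nth[of "i - 1" x] by (auto simp: blocks_def)

lemma sum_blocks_snoc:
  assumes "1 \<le> i"
  shows "(\<Sum>u\<in>blocks i. f (take (i - 1) u) (u ! (i - 1))) =
         (\<Sum>u\<in>blocks (i - 1). \<Sum>a\<in>(UNIV::'a::finite set). f u a)"
proof -
  have "(\<Sum>u\<in>blocks (i - 1). \<Sum>a\<in>(UNIV::'a set). f u a) = (\<Sum>(u, a)\<in>blocks (i - 1) \<times> UNIV. f u a)"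
    by (rule sum.cartesian_product)
  also have "\<dots> = (\<Sum>u\<in>blocks i. f (take (i - 1) u) (u ! (i - 1)))"
    by (rule sum.reindex_bij_witness[of _ "\<lambda>u. (take (i - 1) u, u ! (i - 1))" "\<lambda>(u, a). u @ [a]"])
       (use assms in \<open>auto simp: blocks_def nth_append take_Suc_conv_app_nth[symmetric]\<close>)
  finally show ?thesis by simp
qed

text \<open>The lengths of \<open>u\<close> and \<open>v\<close> tell which prefixes are fixed, so
  prefixes of different lengths on the two sides share one definition; an empty \<open>v\<close>
  gives a source marginal.\<close>

definition marginal :: "nat \<Rightarrow> ('x list \<times> 'y list \<Rightarrow> real) \<Rightarrow> 'x list \<Rightarrow> 'y list \<Rightarrow> real" where
  "marginal n J u v =
     (\<Sum>s | s \<in> blocks n \<times> blocks n \<and> take (length u) (fst s) = u \<and> take (length v) (snd s) = v. J s)"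

text \<open>The causally conditioned probability, usually written p(x || y): the factor of letter
  \<open>i\<close> sees the reproduction up to and including time \<open>i\<close>.\<close>

definition path_prob ::
    "nat \<Rightarrow> (nat \<Rightarrow> 'x list \<Rightarrow> 'y list \<Rightarrow> 'x \<Rightarrow> real) \<Rightarrow> 'x list \<times> 'y list \<Rightarrow> real" where
  "path_prob n q s = (\<Prod>i=1..n. q i (take (i - 1) (fst s)) (take i (snd s)) (fst s ! (i - 1)))"

definition is_kernel :: "nat \<Rightarrow> (nat \<Rightarrow> 'x::finite list \<Rightarrow> 'y list \<Rightarrow> 'x \<Rightarrow> real) \<Rightarrow> bool" where
  "is_kernel n q \<longleftrightarrow> (\<forall>i\<in>{1..n}. \<forall>u\<in>blocks (i - 1). \<forall>v\<in>blocks i.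
     (\<forall>a. 0 \<le> q i u v a) \<and> (\<Sum>a\<in>UNIV. q i u v a) = 1)"

text \<open>The uniform distribution replaces the junk value of \<open>0 / 0\<close>, so that the rows are always normalised.\<close>

definition ff_kernel ::
    "nat \<Rightarrow> ('x::finite list \<times> 'y list \<Rightarrow> real) \<Rightarrow> nat \<Rightarrow> 'x list \<Rightarrow> 'y list \<Rightarrow> 'x \<Rightarrow> real" where
  "ff_kernel n J i u v a =
     (if marginal n J u v = 0 then 1 / real CARD('x) else marginal n J (u @ [a]) v / marginal n J u v)"

text \<open>For a probability mass function \<open>J\<close>, minus the causally conditioned entropy
  H(X || Y) in bits. Directed information differs from it only by the entropy of the source, which
  is the same for all couplings.\<close>

definition ff_info :: "nat \<Rightarrow> ('x::finite list \<times> 'y::finite list \<Rightarrow> real) \<Rightarrow> real" where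
  "ff_info n J = (\<Sum>s\<in>blocks n \<times> blocks n. J s * log 2 (path_prob n (ff_kernel n J) s))"

lemma sum_marginal:
  fixes J :: "'x::finite list \<times> 'y::finite list \<Rightarrow> real"
  assumes "i \<le> n" "k \<le> n"
  shows "(\<Sum>s\<in>blocks n \<times> blocks n. J s * f (take i (fst s)) (take k (snd s))) =
         (\<Sum>u\<in>blocks i. \<Sum>v\<in>blocks k. marginal n J u v * f u v)"
proof -
  let ?S = "blocks n \<times> blocks n :: ('x list \<times> 'y list) set"
  let ?g = "\<lambda>s :: 'x list \<times> 'y list. (take i (fst s), take k (snd s))"
  have "(\<Sum>s\<in>?S. J s * f (take i (fst s)) (take k (snd s))) =
        (\<Sum>w\<in>blocks i \<times> blocks k. \<Sum>s | s \<in> ?S \<and> ?g s = w. J s * f (take i (fst s)) (take k (snd s)))"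
    by (rule sum.group[symmetric]) (use assms in \<open>auto intro: take_in_blocks\<close>)
  also have "\<dots> = (\<Sum>w\<in>blocks i \<times> blocks k. marginal n J (fst w) (snd w) * f (fst w) (snd w))"
    by (rule sum.cong) (auto simp: marginal_def sum_distrib_right blocks_def intro!: sum.cong)
  also have "\<dots> = (\<Sum>u\<in>blocks i. \<Sum>v\<in>blocks k. marginal n J u v * f u v)"
    by (simp add: sum.cartesian_product case_prod_beta)
  finally show ?thesis .
qed

lemma sum_marginal_snoc:
  fixes J :: "'x::finite list \<times> 'y::finite list \<Rightarrow> real"
  assumes "length u < n"
  shows "(\<Sum>a\<in>UNIV. marginal n J (u @ [a]) v) = marginal n J u v"
proof -
  let ?S = "{s. s \<in> blocks n \<times> blocks n \<and> take (length u) (fst s) = u \<and> take (length v) (snd s) = v}"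
  have fin: "finite ?S"
    by (rule finite_subset[of _ "blocks n \<times> blocks n"]) auto
  have "marginal n J u v = (\<Sum>a\<in>UNIV. \<Sum>s | s \<in> ?S \<and> fst s ! length u = a. J s)"
    unfolding marginal_def by (rule sum.group[symmetric]) (use fin in auto)
  also have "\<dots> = (\<Sum>a\<in>UNIV. marginal n J (u @ [a]) v)"
    unfolding marginal_def
    by (intro sum.cong refl) (use assms in \<open>auto simp: blocks_def take_Suc_conv_app_nth\<close>)
  finally show ?thesis by simp
qed

lemma marginal_nonneg:
  "\<forall>s\<in>blocks n \<times> blocks n. 0 \<le> J s \<Longrightarrow> 0 \<le> marginal n J u v"
  unfolding marginal_def by (rule sum_nonneg) auto

text \<open>A pair of positive mass makes every marginal along its prefixes positive, so quotients
  and logarithms of marginals never degenerate where \<open>J s\<close> gives them weight.\<close>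

lemma le_marginal_take:
  fixes J :: "'x::finite list \<times> 'y::finite list \<Rightarrow> real"
  assumes "\<forall>s\<in>blocks n \<times> blocks n. 0 \<le> J s" "s \<in> blocks n \<times> blocks n" "i \<le> n" "k \<le> n"
  shows "J s \<le> marginal n J (take i (fst s)) (take k (snd s))"
  unfolding marginal_def
proof (rule member_le_sum)
  show "finite {t \<in> blocks n \<times> blocks n. take (length (take i (fst s))) (fst t) = take i (fst s) \<and>
      take (length (take k (snd s))) (snd t) = take k (snd s)}"
    by (rule finite_subset[of _ "blocks n \<times> blocks n"]) auto
qed (use assms in \<open>auto simp: blocks_def\<close>)

lemma is_kernel_ff_kernel:
  fixes J :: "'x::finite list \<times> 'y::finite list \<Rightarrow> real"
  assumes "\<forall>s\<in>blocks n \<times> blocks n. 0 \<le> J s"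
  shows "is_kernel n (ff_kernel n J)"
  unfolding is_kernel_def
proof (intro ballI conjI allI)
  fix i and u :: "'x list" and v :: "'y list" assume i: "i \<in> {1..n}" "u \<in> blocks (i - 1)"
  have "length u < n" using i by (auto simp: blocks_def)
  then show "(\<Sum>a\<in>UNIV. ff_kernel n J i u v a) = 1"
    using sum_marginal_snoc[of u n J v]
    by (cases "marginal n J u v = 0") (simp_all add: ff_kernel_def flip: sum_divide_distrib)
  show "0 \<le> ff_kernel n J i u v a" for a
    using marginal_nonneg[of n J, OF assms] by (simp add: ff_kernel_def)
qed

lemma is_kernelD:
  assumes "is_kernel n q" "s \<in> blocks n \<times> blocks n" "i \<in> {1..n}"
  shows "0 \<le> q i (take (i - 1) (fst s)) (take i (snd s)) (fst s ! (i - 1))"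
    and "q i (take (i - 1) (fst s)) (take i (snd s)) (fst s ! (i - 1)) \<le> 1"
proof -
  let ?u = "take (i - 1) (fst s)" and ?v = "take i (snd s)"
  have q: "\<And>a. 0 \<le> q i ?u ?v a" "(\<Sum>a\<in>UNIV. q i ?u ?v a) = 1"
    using assms unfolding is_kernel_def by (auto simp: blocks_def)
  show "0 \<le> q i ?u ?v (fst s ! (i - 1))" by (rule q)
  show "q i ?u ?v (fst s ! (i - 1)) \<le> 1"
    using member_le_sum[of "fst s ! (i - 1)" UNIV "q i ?u ?v"] q by simp
qed

lemma path_prob_nonneg: "is_kernel n q \<Longrightarrow> s \<in> blocks n \<times> blocks n \<Longrightarrow> 0 \<le> path_prob n q s"
  unfolding path_prob_def by (rule prod_nonneg) (blast intro: is_kernelD)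

lemma path_prob_le_1: "is_kernel n q \<Longrightarrow> s \<in> blocks n \<times> blocks n \<Longrightarrow> path_prob n q s \<le> 1"
  unfolding path_prob_def by (rule prod_le_1) (auto intro: is_kernelD simp del: One_nat_def)

lemma path_prob_pos_iff:
  assumes "is_kernel n q" "s \<in> blocks n \<times> blocks n"
  shows "0 < path_prob n q s \<longleftrightarrow>
    (\<forall>i\<in>{1..n}. 0 < q i (take (i - 1) (fst s)) (take i (snd s)) (fst s ! (i - 1)))"
proof -
  have "path_prob n q s \<noteq> 0 \<longleftrightarrow>
      (\<forall>i\<in>{1..n}. q i (take (i - 1) (fst s)) (take i (snd s)) (fst s ! (i - 1)) \<noteq> 0)"
    unfolding path_prob_def by (subst prod_zero_iff) auto
  then show ?thesis
    using path_prob_nonneg[OF assms] is_kernelD(1)[OF assms] by (simp add: less_le eq_commute[of 0])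
qed

lemma log_path_prob:
  assumes "is_kernel n q" "s \<in> blocks n \<times> blocks n" "0 < path_prob n q s"
  shows "log 2 (path_prob n q s) =
    (\<Sum>i=1..n. log 2 (q i (take (i - 1) (fst s)) (take i (snd s)) (fst s ! (i - 1))))"
proof -
  have "q i (take (i - 1) (fst s)) (take i (snd s)) (fst s ! (i - 1)) \<noteq> 0" if "i \<in> {1..n}" for i
    using path_prob_pos_iff[OF assms(1,2)] assms(3) that by force
  then show ?thesis
    unfolding path_prob_def log_def sum_divide_distrib[symmetric] by (subst ln_prod) auto
qed

lemma ff_kernel_take:
  assumes J: "\<forall>s\<in>blocks n \<times> blocks n. 0 \<le> J s"
    and s: "s \<in> blocks n \<times> blocks n" "0 < J s" and i: "i \<in> {1..n}"
  shows "ff_kernel n J i (take (i - 1) (fst s)) (take i (snd s)) (fst s ! (i - 1)) =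
      marginal n J (take i (fst s)) (take i (snd s)) / marginal n J (take (i - 1) (fst s)) (take i (snd s))"
    and "0 < marginal n J (take i (fst s)) (take i (snd s))"
    and "0 < marginal n (J :: 'x::finite list \<times> 'y::finite list \<Rightarrow> real) (take (i - 1) (fst s)) (take i (snd s))"
proof -
  show a: "0 < marginal n J (take i (fst s)) (take i (snd s))"
      "0 < marginal n J (take (i - 1) (fst s)) (take i (snd s))"
    using le_marginal_take[of n J s i i] le_marginal_take[of n J s "i - 1" i] J s i by force+
  show "ff_kernel n J i (take (i - 1) (fst s)) (take i (snd s)) (fst s ! (i - 1)) =
      marginal n J (take i (fst s)) (take i (snd s)) / marginal n J (take (i - 1) (fst s)) (take i (snd s))"
    using a take_pred_append_nth[of "fst s" n i] s i by (auto simp: ff_kernel_def)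
qed

lemma path_prob_ff_kernel_pos:
  fixes J :: "'x::finite list \<times> 'y::finite list \<Rightarrow> real"
  assumes J: "\<forall>s\<in>blocks n \<times> blocks n. 0 \<le> J s"
    and s: "s \<in> blocks n \<times> blocks n" "0 < J s"
  shows "0 < path_prob n (ff_kernel n J) s"
  unfolding path_prob_def
  by (rule prod_pos) (use ff_kernel_take[OF assms] in auto)

text \<open>By \<open>ln z \<le> z - 1\<close>, the difference of the two sides is controlled by the
  mean under \<open>J\<close> of the likelihood ratio minus 1. That mean ratio is at most the total
  mass of \<open>J\<close>, because the rows of \<open>q\<close> sum to 1.\<close>

lemma gibbs_factor:
  fixes J :: "'x::finite list \<times> 'y::finite list \<Rightarrow> real"
  assumes J: "\<forall>s\<in>blocks n \<times> blocks n. 0 \<le> J s"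
    and q: "is_kernel n q" and i: "i \<in> {1..n}"
    and pos: "\<And>s. s \<in> blocks n \<times> blocks n \<Longrightarrow> 0 < J s \<Longrightarrow>
      0 < q i (take (i - 1) (fst s)) (take i (snd s)) (fst s ! (i - 1))"
  shows "(\<Sum>s\<in>blocks n \<times> blocks n. J s * log 2 (q i (take (i - 1) (fst s)) (take i (snd s)) (fst s ! (i - 1))))
    \<le> (\<Sum>s\<in>blocks n \<times> blocks n. J s * log 2 (ff_kernel n J i (take (i - 1) (fst s)) (take i (snd s)) (fst s ! (i - 1))))"
proof -
  let ?S = "blocks n \<times> blocks n :: ('x list \<times> 'y list) set"
  let ?q = "\<lambda>s. q i (take (i - 1) (fst s)) (take i (snd s)) (fst s ! (i - 1))"
  let ?k = "\<lambda>s. ff_kernel n J i (take (i - 1) (fst s)) (take i (snd s)) (fst s ! (i - 1))"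
  \<comment> \<open>The likelihood ratio of \<open>q\<close> to the kernel of \<open>J\<close>, as a
    function of the two prefixes of length \<open>i\<close>, so that \<open>sum_marginal\<close>
    applies. It is 0 on prefixes without mass, hence only an inequality in the second step of the
    chain below.\<close>
  define r where "r = (\<lambda>u v. if marginal n J u v = 0 then 0
    else q i (take (i - 1) u) v (u ! (i - 1)) * marginal n J (take (i - 1) u) v / marginal n J u v)"
  have le: "J s * log 2 (?q s) - J s * log 2 (?k s) \<le>
      (J s * r (take i (fst s)) (take i (snd s)) - J s * 1) / ln 2" if s: "s \<in> ?S" for s
  proof (cases "J s = 0")
    case False
    then have Js: "0 < J s" using J s by (metis less_eq_real_def)
    note k = ff_kernel_take[OF J s Js i]
    have "?q s / ?k s = r (take i (fst s)) (take i (snd s))"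
      using k i s by (auto simp: r_def blocks_def min_def)
    moreover have kq: "0 < ?k s" "0 < ?q s" using k pos[OF s Js] by auto
    ultimately have "ln (?q s) - ln (?k s) \<le> r (take i (fst s)) (take i (snd s)) - 1"
      using ln_le_minus_one[of "?q s / ?k s"] divide_pos_pos[OF kq(2,1)] ln_divide_pos[OF kq(2,1)]
      by linarith
    then have "log 2 (?q s) - log 2 (?k s) \<le> (r (take i (fst s)) (take i (snd s)) - 1) / ln 2"
      unfolding log_def diff_divide_distrib[symmetric] by (rule divide_right_mono) simp
    then have "J s * (log 2 (?q s) - log 2 (?k s)) \<le> J s * ((r (take i (fst s)) (take i (snd s)) - 1) / ln 2)"
      using Js by (intro mult_left_mono) auto
    then show ?thesis by (simp add: algebra_simps)
  qed simp
  have "(\<Sum>s\<in>?S. J s * r (take i (fst s)) (take i (snd s))) =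
      (\<Sum>u\<in>blocks i. \<Sum>v\<in>blocks i. marginal n J u v * r u v)"
    using i by (intro sum_marginal) auto
  also have "\<dots> \<le> (\<Sum>u\<in>blocks i. \<Sum>v\<in>blocks i.
      q i (take (i - 1) u) v (u ! (i - 1)) * marginal n J (take (i - 1) u) v)"
  proof (intro sum_mono)
    fix u :: "'x list" and v :: "'y list" assume "u \<in> blocks i" "v \<in> blocks i"
    then have "0 \<le> q i (take (i - 1) u) v (u ! (i - 1))"
      using q i unfolding is_kernel_def by (auto simp: blocks_def)
    then show "marginal n J u v * r u v \<le> q i (take (i - 1) u) v (u ! (i - 1)) * marginal n J (take (i - 1) u) v"
      using marginal_nonneg[of n J, OF J] by (auto simp: r_def)
  qed
  \<comment> \<open>Splitting the last letter off \<open>u\<close> exposes the sum of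
    \<open>q\<close> over a whole row.\<close>
  also have "\<dots> = (\<Sum>u\<in>blocks (i - 1). \<Sum>a\<in>UNIV. \<Sum>v\<in>blocks i. q i u v a * marginal n J u v)"
    using i by (intro sum_blocks_snoc) auto
  also have "\<dots> = (\<Sum>u\<in>blocks (i - 1). \<Sum>v\<in>blocks i. marginal n J u v * 1)"
  proof (rule sum.cong[OF refl])
    fix u :: "'x list" assume u: "u \<in> blocks (i - 1)"
    have "(\<Sum>a\<in>UNIV. \<Sum>v\<in>blocks i. q i u v a * marginal n J u v) =
        (\<Sum>v\<in>blocks i. (\<Sum>a\<in>UNIV. q i u v a) * marginal n J u v)"
      by (subst sum.swap) (simp add: sum_distrib_right)
    also have "\<dots> = (\<Sum>v\<in>blocks i. marginal n J u v * 1)"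
      using q i u unfolding is_kernel_def by (intro sum.cong) auto
    finally show "(\<Sum>a\<in>UNIV. \<Sum>v\<in>blocks i. q i u v a * marginal n J u v) =
        (\<Sum>v\<in>blocks i. marginal n J u v * 1)" .
  qed
  also have "\<dots> = (\<Sum>s\<in>?S. J s * 1)"
    using i by (intro sum_marginal[symmetric]) auto
  finally have le_0: "(\<Sum>s\<in>?S. (J s * r (take i (fst s)) (take i (snd s)) - J s * 1) / ln 2) \<le> 0"
    by (simp add: sum_subtractf divide_nonpos_pos flip: sum_divide_distrib)
  have "(\<Sum>s\<in>?S. J s * log 2 (?q s)) - (\<Sum>s\<in>?S. J s * log 2 (?k s)) \<le>
      (\<Sum>s\<in>?S. (J s * r (take i (fst s)) (take i (snd s)) - J s * 1) / ln 2)"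
    unfolding sum_subtractf[symmetric] by (rule sum_mono) (rule le)
  with le_0 show ?thesis by linarith
qed

text \<open>The logarithm of the path probability splits into one term per letter, and each letter
  is a case of \<open>gibbs_factor\<close>. Positivity on the support of \<open>J\<close> matters: a
  vanishing \<open>q\<close> would contribute \<open>log 2 0 = 0\<close> where the true value is
  minus infinity.\<close>

lemma gibbs_ff_info:
  fixes J :: "'x::finite list \<times> 'y::finite list \<Rightarrow> real"
  assumes J: "\<forall>s\<in>blocks n \<times> blocks n. 0 \<le> J s"
    and q: "is_kernel n q"
    and pos: "\<And>s. s \<in> blocks n \<times> blocks n \<Longrightarrow> 0 < J s \<Longrightarrow> 0 < path_prob n q s"
  shows "(\<Sum>s\<in>blocks n \<times> blocks n. J s * log 2 (path_prob n q s)) \<le> ff_info n J"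
proof -
  let ?S = "blocks n \<times> blocks n :: ('x list \<times> 'y list) set"
  have split: "(\<Sum>s\<in>?S. J s * log 2 (path_prob n q s)) = (\<Sum>i=1..n. \<Sum>s\<in>?S.
      J s * log 2 (q i (take (i - 1) (fst s)) (take i (snd s)) (fst s ! (i - 1))))"
    if q: "is_kernel n q" and pos: "\<And>s. s \<in> ?S \<Longrightarrow> 0 < J s \<Longrightarrow> 0 < path_prob n q s" for q
  proof -
    have "J s * log 2 (path_prob n q s) = (\<Sum>i=1..n.
        J s * log 2 (q i (take (i - 1) (fst s)) (take i (snd s)) (fst s ! (i - 1))))" if "s \<in> ?S" for s
      using log_path_prob[OF q that] pos[OF that] J that
      by (cases "J s = 0") (auto simp: less_eq_real_def simp flip: sum_distrib_left)
    then show ?thesis by (subst sum.swap) (rule sum.cong, auto)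
  qed
  have "(\<Sum>s\<in>?S. J s * log 2 (path_prob n q s)) = (\<Sum>i=1..n. \<Sum>s\<in>?S.
      J s * log 2 (q i (take (i - 1) (fst s)) (take i (snd s)) (fst s ! (i - 1))))"
    by (rule split[OF q pos])
  also have "\<dots> \<le> (\<Sum>i=1..n. \<Sum>s\<in>?S.
      J s * log 2 (ff_kernel n J i (take (i - 1) (fst s)) (take i (snd s)) (fst s ! (i - 1))))"
    by (rule sum_mono, rule gibbs_factor[OF J q]) (use pos path_prob_pos_iff[OF q] in auto)
  also have "\<dots> = ff_info n J"
    unfolding ff_info_def
    by (rule split[OF is_kernel_ff_kernel[OF J] path_prob_ff_kernel_pos[OF J], symmetric])
  finally show ?thesis .
qed

subsection \<open>Compactness and continuity\<close>

lemma continuous_on_mult_log_self: "continuous_on {0..} (\<lambda>t::real. t * log 2 t)"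
  unfolding continuous_on_def
proof
  fix t :: real assume "t \<in> {0..}"
  show "((\<lambda>t. t * log 2 t) \<longlongrightarrow> t * log 2 t) (at t within {0..})"
  proof (cases "t = 0")
    case True
    have "((\<lambda>t::real. t * log 2 t) \<longlongrightarrow> 0) (at_right 0)"
      by real_asymp
    then show ?thesis
      by (simp add: True at_within_Ici_at_right)
  next
    case False
    then show ?thesis using \<open>t \<in> {0..}\<close> by (auto intro!: tendsto_eq_intros)
  qed
qed

text \<open>Where \<open>g\<close> vanishes so does \<open>f\<close>, and the product is dominated
  by \<open>g * log 2 g\<close>, which tends to 0. The intended \<open>f\<close> is a mass
  \<open>J s\<close> and the intended \<open>g\<close> a marginal that contains it.\<close>

lemma continuous_on_mult_log:
  fixes f g :: "'a::topological_space \<Rightarrow> real"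
  assumes f: "continuous_on A f" and g: "continuous_on A g"
    and le: "\<And>x. x \<in> A \<Longrightarrow> 0 \<le> f x \<and> f x \<le> g x"
  shows "continuous_on A (\<lambda>x. f x * log 2 (g x))"
  unfolding continuous_on_def
proof
  fix x assume x: "x \<in> A"
  have f': "(f \<longlongrightarrow> f x) (at x within A)" and g': "(g \<longlongrightarrow> g x) (at x within A)"
    using f g x by (auto simp: continuous_on_def)
  show "((\<lambda>x. f x * log 2 (g x)) \<longlongrightarrow> f x * log 2 (g x)) (at x within A)"
  proof (cases "g x = 0")
    case False
    then have "0 < g x" using le[OF x] by linarith
    then show ?thesis by (intro tendsto_intros f' g') auto
  next
    case True
    then have fx: "f x = 0" using le[OF x] by linarith
    have "continuous_on A (\<lambda>x. g x * log 2 (g x))"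
      by (rule continuous_on_compose2[OF continuous_on_mult_log_self g]) (use le in force)
    then have lim: "((\<lambda>y. g y * log 2 (g y)) \<longlongrightarrow> 0) (at x within A)"
      using x True by (force simp: continuous_on_def)
    have "norm (f y * log 2 (g y)) \<le> \<bar>g y * log 2 (g y)\<bar>" if "y \<in> A" for y
      using le[OF that] mult_right_mono[of "\<bar>f y\<bar>" "\<bar>g y\<bar>" "\<bar>log 2 (g y)\<bar>"]
      by (simp add: abs_mult)
    then have "\<forall>\<^sub>F y in at x within A. norm (f y * log 2 (g y)) \<le> \<bar>g y * log 2 (g y)\<bar>"
      by (simp add: eventually_at_filter)
    then have "((\<lambda>y. f y * log 2 (g y)) \<longlongrightarrow> 0) (at x within A)"
      using tendsto_rabs_zero[OF lim] by (rule Lim_null_comparison)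
    then show ?thesis by (simp add: fx)
  qed
qed

text \<open>Blocks live in the infinite type of lists, so functions on them form an infinite
  product; compactness is Tychonoff's theorem for the product topology.\<close>

lemma compact_box_functions: "compact {f :: 'a \<Rightarrow> real. \<forall>a. lo \<le> f a \<and> f a \<le> hi}"
proof -
  have "{f :: 'a \<Rightarrow> real. \<forall>a. lo \<le> f a \<and> f a \<le> hi} = PiE UNIV (\<lambda>_. {lo..hi})"
    by (auto simp: PiE_def Pi_def)
  then show ?thesis
    using compactin_PiE[of "\<lambda>_. euclidean" UNIV "\<lambda>_::'a. {lo..hi}"]
    by (simp add: euclidean_product_topology)
qed

lemma continuous_on_component: "continuous_on A (\<lambda>f :: 'a \<Rightarrow> 'b::topological_space. f a)"
  by (rule continuous_on_subset[OF continuous_on_product_coordinates]) simp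

text \<open>The bounds are imposed at all pairs of lists, not only at blocks, so that the set is
  compact in the product topology.\<close>

definition couplings :: "nat \<Rightarrow> 'x::finite list pmf \<Rightarrow> ('x list \<times> 'y::finite list \<Rightarrow> real) set" where
  "couplings n P = {J. (\<forall>s. 0 \<le> J s \<and> J s \<le> 1) \<and>
     (\<forall>x\<in>blocks n. (\<Sum>y\<in>blocks n. J (x, y)) = pmf P x)}"

lemma couplingsD:
  assumes "J \<in> couplings n P"
  shows "0 \<le> J s" "\<forall>s\<in>blocks n \<times> blocks n. 0 \<le> J s"
    "x \<in> blocks n \<Longrightarrow> (\<Sum>y\<in>blocks n. J (x, y)) = pmf P x"
  using assms by (auto simp: couplings_def simp del: split_paired_All)

lemma compact_couplings: "compact (couplings n P)"
proof -
  have "closed {J. \<forall>x\<in>blocks n. (\<Sum>y\<in>blocks n. J (x, y)) = pmf P x}"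
    unfolding Ball_def
    by (intro closed_Collect_all closed_Collect_imp open_Collect_const closed_Collect_eq
        continuous_on_sum continuous_on_component continuous_on_const)
  from compact_Int_closed[OF compact_box_functions this] show ?thesis
    unfolding couplings_def by (rule back_subst[of compact]) auto
qed

lemma continuous_on_marginal: "continuous_on A (\<lambda>J. marginal n J u v)"
  unfolding marginal_def by (intro continuous_on_sum continuous_on_component)

text \<open>The kernel may jump where a marginal vanishes, but each product of \<open>J s\<close>
  with the logarithm of one marginal is continuous there. The same form is met again when the
  directed information is expanded.\<close>

lemma ff_info_eq_marginals:
  fixes J :: "'x::finite list \<times> 'y::finite list \<Rightarrow> real"
  assumes J: "\<forall>s\<in>blocks n \<times> blocks n. 0 \<le> J s"
  shows "ff_info n J = (\<Sum>s\<in>blocks n \<times> blocks n. \<Sum>i=1..n.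
      J s * log 2 (marginal n J (take i (fst s)) (take i (snd s))) -
      J s * log 2 (marginal n J (take (i - 1) (fst s)) (take i (snd s))))"
  unfolding ff_info_def
proof (rule sum.cong[OF refl])
  fix s :: "'x list \<times> 'y list" assume s: "s \<in> blocks n \<times> blocks n"
  show "J s * log 2 (path_prob n (ff_kernel n J) s) = (\<Sum>i=1..n.
      J s * log 2 (marginal n J (take i (fst s)) (take i (snd s))) -
      J s * log 2 (marginal n J (take (i - 1) (fst s)) (take i (snd s))))"
  proof (cases "J s = 0")
    case False
    then have Js: "0 < J s" using J s by (metis less_eq_real_def)
    have "J s * log 2 (path_prob n (ff_kernel n J) s) = (\<Sum>i=1..n. J s *
        log 2 (ff_kernel n J i (take (i - 1) (fst s)) (take i (snd s)) (fst s ! (i - 1))))"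
      using log_path_prob[OF is_kernel_ff_kernel[OF J] s path_prob_ff_kernel_pos[OF J s Js]]
      by (simp only: sum_distrib_left)
    also have "\<dots> = (\<Sum>i=1..n.
      J s * log 2 (marginal n J (take i (fst s)) (take i (snd s))) -
      J s * log 2 (marginal n J (take (i - 1) (fst s)) (take i (snd s))))"
    proof (rule sum.cong[OF refl])
      fix i assume "i \<in> {1..n}"
      note k = ff_kernel_take[OF J s Js this]
      show "J s * log 2 (ff_kernel n J i (take (i - 1) (fst s)) (take i (snd s)) (fst s ! (i - 1))) =
        J s * log 2 (marginal n J (take i (fst s)) (take i (snd s))) -
        J s * log 2 (marginal n J (take (i - 1) (fst s)) (take i (snd s)))"
        unfolding k(1) log_divide_pos[OF k(2,3)] by (rule right_diff_distrib)
    qed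
    finally show ?thesis .
  qed simp
qed

lemma continuous_on_ff_info:
  fixes P :: "'x::finite list pmf"
  shows "continuous_on (couplings n P :: ('x list \<times> 'y::finite list \<Rightarrow> real) set) (ff_info n)"
proof -
  have "continuous_on (couplings n P) (\<lambda>J :: 'x list \<times> 'y list \<Rightarrow> real. \<Sum>s\<in>blocks n \<times> blocks n. \<Sum>i=1..n.
      J s * log 2 (marginal n J (take i (fst s)) (take i (snd s))) -
      J s * log 2 (marginal n J (take (i - 1) (fst s)) (take i (snd s))))"
  proof (intro continuous_on_sum continuous_on_diff)
    fix s :: "'x list \<times> 'y list" and i assume s: "s \<in> blocks n \<times> blocks n" and i: "i \<in> {1..n}"
    have c: "continuous_on (couplings n P) (\<lambda>J. J s * log 2 (marginal n J (take j (fst s)) (take i (snd s))))"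
      if "j \<le> n" for j
    proof (rule continuous_on_mult_log[OF continuous_on_component continuous_on_marginal])
      fix J :: "'x list \<times> 'y list \<Rightarrow> real" assume J: "J \<in> couplings n P"
      show "0 \<le> J s \<and> J s \<le> marginal n J (take j (fst s)) (take i (snd s))"
        using couplingsD(1)[OF J] le_marginal_take[OF couplingsD(2)[OF J] s that, of i] i by auto
    qed
    show "continuous_on (couplings n P) (\<lambda>J. J s * log 2 (marginal n J (take i (fst s)) (take i (snd s))))"
      using i by (intro c) simp
    show "continuous_on (couplings n P) (\<lambda>J. J s * log 2 (marginal n J (take (i - 1) (fst s)) (take i (snd s))))"
      using i by (intro c) auto
  qed
  then show ?thesis
    by (rule continuous_on_eq) (simp only: ff_info_eq_marginals[OF couplingsD(2)])
qed

subsection \<open>Weak duality\<close>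

lemma couplings_le:
  assumes "J \<in> couplings n P" "s \<in> blocks n \<times> blocks n"
  shows "J s \<le> pmf P (fst s)"
proof -
  have "J (fst s, snd s) \<le> (\<Sum>y\<in>blocks n. J (fst s, y))"
    by (rule member_le_sum) (use assms in \<open>auto simp: couplingsD(1)[OF assms(1)]\<close>)
  then show ?thesis using couplingsD(3)[OF assms(1), of "fst s"] assms(2) by auto
qed

lemma sum_couplings_fst:
  fixes J :: "'x::finite list \<times> 'y::finite list \<Rightarrow> real"
  assumes "J \<in> couplings n P"
  shows "(\<Sum>s\<in>blocks n \<times> blocks n. J s * g (fst s)) = (\<Sum>x\<in>blocks n. pmf P x * g x)"
proof -
  have "(\<Sum>s\<in>blocks n \<times> blocks n. J s * g (fst s)) = (\<Sum>x\<in>blocks n. \<Sum>y\<in>blocks n. J (x, y) * g x)"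
    by (simp add: sum.cartesian_product case_prod_beta)
  also have "\<dots> = (\<Sum>x\<in>blocks n. pmf P x * g x)"
    by (intro sum.cong refl) (simp add: couplingsD(3)[OF assms] flip: sum_distrib_right)
  finally show ?thesis .
qed

text \<open>An inequality, since mass of \<open>P\<close> outside \<open>blocks n\<close> is not
  excluded here.\<close>

lemma sum_couplings_le_1:
  fixes J :: "'x::finite list \<times> 'y::finite list \<Rightarrow> real"
  assumes "J \<in> couplings n P"
  shows "(\<Sum>s\<in>blocks n \<times> blocks n. J s) \<le> 1"
  using sum_couplings_fst[OF assms, of "\<lambda>_. 1"] measure_measure_pmf_finite[of "blocks n" P]
    measure_pmf.prob_le_1[of P "blocks n"] by simp

lemma couplings_mix:
  assumes "J \<in> couplings n P" "J' \<in> couplings n P" "0 \<le> t" "t \<le> 1"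
  shows "(\<lambda>s. (1 - t) * J s + t * J' s) \<in> couplings n P"
proof -
  have "0 \<le> (1 - t) * J s + t * J' s \<and> (1 - t) * J s + t * J' s \<le> 1" for s
  proof -
    have b: "0 \<le> J s" "0 \<le> J' s" "J s \<le> 1" "J' s \<le> 1"
      using assms(1,2) unfolding couplings_def by blast+
    show ?thesis
      using b assms(3,4) convex_bound_le[of "J s" 1 "J' s" "1 - t" t] by simp
  qed
  moreover have "(\<Sum>y\<in>blocks n. (1 - t) * J (x, y) + t * J' (x, y)) = pmf P x" if "x \<in> blocks n" for x
    unfolding sum.distrib sum_distrib_left[symmetric] couplingsD(3)[OF assms(1) that]
      couplingsD(3)[OF assms(2) that] by (simp add: algebra_simps)
  ultimately show ?thesis by (simp add: couplings_def)
qed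

definition uniform_coupling :: "nat \<Rightarrow> 'x::finite list pmf \<Rightarrow> 'x list \<times> 'y::finite list \<Rightarrow> real" where
  "uniform_coupling n P s = pmf P (fst s) / real (card (blocks n :: 'y list set))"

lemma card_blocks_pos: "0 < real (card (blocks n :: 'a::finite list set))"
  by (simp add: card_gt_0_iff)

lemma uniform_coupling_in: "uniform_coupling n P \<in> couplings n P"
proof -
  have "pmf P x / real (card (blocks n :: 'b list set)) \<le> 1" for x
    using pmf_le_1[of P x] card_blocks_pos[where 'a='b, of n] by (simp add: divide_le_eq)
  then show ?thesis
    using card_blocks_pos[where 'a='b, of n] by (auto simp: couplings_def uniform_coupling_def)
qed

definition mean_distortion ::
    "nat \<Rightarrow> ('x list \<Rightarrow> 'y list \<Rightarrow> real) \<Rightarrow> ('x list \<times> 'y list \<Rightarrow> real) \<Rightarrow> real" where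
  "mean_distortion n d J = (\<Sum>s\<in>blocks n \<times> blocks n. J s * d (fst s) (snd s))"

definition source_entropy :: "nat \<Rightarrow> 'x list pmf \<Rightarrow> real" where
  "source_entropy n P = - (\<Sum>x\<in>blocks n. pmf P x * log 2 (pmf P x))"

lemma continuous_on_mean_distortion: "continuous_on A (mean_distortion n d)"
  unfolding mean_distortion_def[abs_def]
  by (intro continuous_on_sum continuous_on_mult_right continuous_on_component)

lemma mean_distortion_mix:
  "mean_distortion n d (\<lambda>s. a * J s + b * J' s) = a * mean_distortion n d J + b * mean_distortion n d J'"
  by (simp add: mean_distortion_def sum.distrib sum_distrib_left algebra_simps)

lemma mean_distortion_nonneg:
  assumes "J \<in> couplings n P" "\<And>x y. x \<in> blocks n \<Longrightarrow> y \<in> blocks n \<Longrightarrow> 0 \<le> d x y"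
  shows "0 \<le> mean_distortion n d J"
  unfolding mean_distortion_def
  by (rule sum_nonneg) (auto intro!: mult_nonneg_nonneg couplingsD(1)[OF assms(1)] assms(2))

lemma mean_distortion_le:
  assumes J: "J \<in> couplings n P" and M: "\<And>x y. x \<in> blocks n \<Longrightarrow> y \<in> blocks n \<Longrightarrow> d x y \<le> M"
    and "0 \<le> M"
  shows "mean_distortion n d J \<le> M"
proof -
  have "mean_distortion n d J \<le> (\<Sum>s\<in>blocks n \<times> blocks n. J s * M)"
    unfolding mean_distortion_def
    by (intro sum_mono mult_left_mono M couplingsD(1)[OF J]) auto
  also have "\<dots> \<le> M"
    using mult_right_mono[OF sum_couplings_le_1[OF J] \<open>0 \<le> M\<close>] by (simp add: sum_distrib_right)
  finally show ?thesis .
qed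

lemma elog2_mult: "0 \<le> a \<Longrightarrow> 0 \<le> b \<Longrightarrow> elog2 (a * b) = elog2 a + elog2 b"
  by (auto simp: elog2_def log_mult zero_less_mult_iff)

lemma elog2_prod:
  "finite I \<Longrightarrow> (\<And>i. i \<in> I \<Longrightarrow> 0 \<le> f i) \<Longrightarrow> elog2 (\<Prod>i\<in>I. f i) = (\<Sum>i\<in>I. elog2 (f i))"
  by (induction I rule: finite_induct) (auto simp: elog2_mult prod_nonneg, simp add: elog2_def)

text \<open>Exponentiating removes the extended reals: \<open>elog2\<close> never takes the value
  plus infinity, so it turns products of nonnegative numbers into sums without exception.\<close>

lemma gp_feasible_iff:
  "gp_feasible n P d l \<gamma> q \<longleftrightarrow> 0 \<le> l \<and> (\<forall>x\<in>blocks n. 0 < \<gamma> x) \<and> is_kernel n q \<and>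
     (\<forall>x\<in>blocks n. \<forall>y\<in>blocks n. pmf P x * \<gamma> x \<le> 2 powr (l * d x y) * path_prob n q (x, y))"
proof -
  have "elog2 (pmf P x) + elog2 (\<gamma> x) - ereal (l * d x y)
          \<le> (\<Sum>i=1..n. elog2 (q i (take (i - 1) x) (take i y) (x ! (i - 1)))) \<longleftrightarrow>
        pmf P x * \<gamma> x \<le> 2 powr (l * d x y) * path_prob n q (x, y)"
    if q: "is_kernel n q" and g: "0 < \<gamma> x" and x: "x \<in> blocks n" and y: "y \<in> blocks n" for x y
  proof -
    have s: "(x, y) \<in> blocks n \<times> blocks n" using x y by simp
    have sum: "(\<Sum>i=1..n. elog2 (q i (take (i - 1) x) (take i y) (x ! (i - 1)))) = elog2 (path_prob n q (x, y))"
      unfolding path_prob_def by (subst elog2_prod) (use is_kernelD(1)[OF q s] in auto)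
    have nonneg: "0 \<le> path_prob n q (x, y)" by (rule path_prob_nonneg[OF q s])
    show ?thesis
    \<comment> \<open>If \<open>pmf P x = 0\<close>, both sides of the equivalence hold; if only the
      path probability is 0, both fail because \<open>\<gamma> x\<close> is positive.\<close>
    proof (cases "pmf P x = 0 \<or> path_prob n q (x, y) = 0")
      case True
      then show ?thesis
        unfolding sum using g nonneg pmf_nonneg[of P x] mult_pos_pos[OF _ g, of "pmf P x"]
        by (cases "pmf P x = 0") (simp_all add: elog2_def less_le[of 0 "pmf P x"] not_le)
    next
      case False
      then have pos: "0 < pmf P x" "0 < path_prob n q (x, y)"
        using nonneg pmf_nonneg[of P x] by linarith+
      have "pmf P x * \<gamma> x \<le> 2 powr (l * d x y) * path_prob n q (x, y) \<longleftrightarrow>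
          log 2 (pmf P x * \<gamma> x) \<le> log 2 (2 powr (l * d x y) * path_prob n q (x, y))"
        using pos g by (subst log_le_cancel_iff) auto
      then show ?thesis
        unfolding sum using pos g by (auto simp: elog2_def log_mult)
    qed
  qed
  then show ?thesis
    unfolding gp_feasible_def is_kernel_def by blast
qed

text \<open>The logarithmic constraint is averaged with the weights \<open>J\<close>, and Gibbs'
  inequality then replaces \<open>q\<close> by the kernel of \<open>J\<close>; the constraint itself
  supplies the positivity that Gibbs requires. The mean distortion is kept instead of
  \<open>D\<close>, so that the bound can also be used at a strictly feasible coupling to limit
  \<open>l\<close>.\<close>

lemma weak_duality:
  fixes J :: "'x::finite list \<times> 'y::finite list \<Rightarrow> real"
  assumes feas: "gp_feasible n P d l \<gamma> q" and J: "J \<in> couplings n P"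
  shows "(\<Sum>x\<in>blocks n. pmf P x * log 2 (\<gamma> x)) \<le>
    ff_info n J + source_entropy n P + l * mean_distortion n d J"
proof -
  let ?S = "blocks n \<times> blocks n :: ('x list \<times> 'y list) set"
  have q: "is_kernel n q" and g: "\<And>x. x \<in> blocks n \<Longrightarrow> 0 < \<gamma> x"
    and c: "\<And>x y. x \<in> blocks n \<Longrightarrow> y \<in> blocks n \<Longrightarrow>
      pmf P x * \<gamma> x \<le> 2 powr (l * d x y) * path_prob n q (x, y)"
    using feas unfolding gp_feasible_iff by auto
  have pos: "0 < pmf P (fst s)" "0 < path_prob n q s" if "s \<in> ?S" "0 < J s" for s
  proof -
    show 1: "0 < pmf P (fst s)" using couplings_le[OF J that(1)] that(2) by linarith
    have "0 < pmf P (fst s) * \<gamma> (fst s)" using 1 g that by auto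
    also have "\<dots> \<le> 2 powr (l * d (fst s) (snd s)) * path_prob n q s"
      using c[of "fst s" "snd s"] that by auto
    finally show "0 < path_prob n q s" by (simp add: zero_less_mult_iff)
  qed
  have "J s * (log 2 (pmf P (fst s)) + log 2 (\<gamma> (fst s))) \<le>
      J s * log 2 (path_prob n q s) + l * (J s * d (fst s) (snd s))" if s: "s \<in> ?S" for s
  proof (cases "J s = 0")
    case False
    then have Js: "0 < J s" using couplingsD(1)[OF J, of s] by linarith
    note p = pos[OF s Js] g[of "fst s"]
    have "log 2 (pmf P (fst s) * \<gamma> (fst s)) \<le> log 2 (2 powr (l * d (fst s) (snd s)) * path_prob n q s)"
      using c[of "fst s" "snd s"] s p by (subst log_le_cancel_iff) auto
    then have "log 2 (pmf P (fst s)) + log 2 (\<gamma> (fst s)) \<le> log 2 (path_prob n q s) + l * d (fst s) (snd s)"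
      using s p by (auto simp: log_mult)
    then have "J s * (log 2 (pmf P (fst s)) + log 2 (\<gamma> (fst s))) \<le>
        J s * (log 2 (path_prob n q s) + l * d (fst s) (snd s))"
      using Js by (intro mult_left_mono) auto
    then show ?thesis by (simp add: algebra_simps)
  qed simp
  then have "(\<Sum>s\<in>?S. J s * (log 2 (pmf P (fst s)) + log 2 (\<gamma> (fst s)))) \<le>
      (\<Sum>s\<in>?S. J s * log 2 (path_prob n q s) + l * (J s * d (fst s) (snd s)))"
    by (rule sum_mono)
  also have "\<dots> = (\<Sum>s\<in>?S. J s * log 2 (path_prob n q s)) + l * mean_distortion n d J"
    by (simp add: sum.distrib mean_distortion_def sum_distrib_left)
  also have "(\<Sum>s\<in>?S. J s * log 2 (path_prob n q s)) \<le> ff_info n J"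
    by (rule gibbs_ff_info[OF couplingsD(2)[OF J] q]) (use pos in auto)
  finally show ?thesis
    using sum_couplings_fst[OF J, of "\<lambda>x. log 2 (pmf P x) + log 2 (\<gamma> x)"]
    by (simp add: source_entropy_def sum.distrib distrib_left)
qed

text \<open>At a pair of positive limit mass the denominators of the kernel have positive limits,
  and eventually \<open>F t s\<close> is positive too, so the default value in
  \<open>ff_kernel\<close> does not intervene.\<close>

lemma tendsto_path_prob_ff_kernel:
  fixes J :: "'x::finite list \<times> 'y::finite list \<Rightarrow> real"
  assumes lim: "\<And>s. ((\<lambda>t. F t s) \<longlongrightarrow> J s) G"
    and F: "\<forall>\<^sub>F t in G. \<forall>s\<in>blocks n \<times> blocks n. 0 \<le> F t s"
    and J: "\<forall>s\<in>blocks n \<times> blocks n. 0 \<le> J s"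
    and s: "s \<in> blocks n \<times> blocks n" "0 < J s"
  shows "((\<lambda>t. path_prob n (ff_kernel n (F t)) s) \<longlongrightarrow> path_prob n (ff_kernel n J) s) G"
  unfolding path_prob_def
proof (rule tendsto_prod)
  fix i assume i: "i \<in> {1..n}"
  have marg: "((\<lambda>t. marginal n (F t) u v) \<longlongrightarrow> marginal n J u v) G" for u v
    unfolding marginal_def by (intro tendsto_sum lim)
  have "((\<lambda>t. marginal n (F t) (take i (fst s)) (take i (snd s)) /
        marginal n (F t) (take (i - 1) (fst s)) (take i (snd s))) \<longlongrightarrow>
      ff_kernel n J i (take (i - 1) (fst s)) (take i (snd s)) (fst s ! (i - 1))) G"
    unfolding ff_kernel_take(1)[OF J s i]
    by (intro tendsto_divide marg) (use ff_kernel_take(3)[OF J s i] in simp)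
  moreover have "\<forall>\<^sub>F t in G. marginal n (F t) (take i (fst s)) (take i (snd s)) /
        marginal n (F t) (take (i - 1) (fst s)) (take i (snd s)) =
      ff_kernel n (F t) i (take (i - 1) (fst s)) (take i (snd s)) (fst s ! (i - 1))"
    using F order_tendstoD(1)[OF lim s(2)]
    by eventually_elim (rule ff_kernel_take(1)[OF _ s(1) _ i, symmetric], auto)
  ultimately show "((\<lambda>t. ff_kernel n (F t) i (take (i - 1) (fst s)) (take i (snd s)) (fst s ! (i - 1))) \<longlongrightarrow>
      ff_kernel n J i (take (i - 1) (fst s)) (take i (snd s)) (fst s ! (i - 1))) G"
    by (rule Lim_transform_eventually)
qed

subsection \<open>Penalised minimisation\<close>

text \<open>
  Gibbs' inequality replaces the differentiation of \<open>ff_info\<close>: along the segment from the minimiser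
  \<open>J\<close> to \<open>J'\<close> it bounds the increment of \<open>ff_info\<close> by a term linear in \<open>J' - J\<close> whose coefficients
  are the logarithms of the current kernel.
\<close>

lemma penalised_first_order:
  fixes J J' :: "'x::finite list \<times> 'y::finite list \<Rightarrow> real"
    and d :: "'x list \<Rightarrow> 'y list \<Rightarrow> real" and n :: nat and \<kappa> D :: real
  defines "\<Phi> \<equiv> \<lambda>J. ff_info n J + \<kappa> * (max 0 (mean_distortion n d J - D))\<^sup>2"
  assumes J: "J \<in> couplings n P" and J': "J' \<in> couplings n P"
    and pos: "\<And>s. s \<in> blocks n \<times> blocks n \<Longrightarrow> 0 < pmf P (fst s) \<Longrightarrow> 0 < J s"
    and \<kappa>: "0 \<le> \<kappa>"
    and min: "\<And>t. 0 < t \<Longrightarrow> t < 1 \<Longrightarrow> \<Phi> J \<le> \<Phi> (\<lambda>s. (1 - t) * J s + t * J' s)"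
  shows "0 \<le> (\<Sum>s\<in>blocks n \<times> blocks n. (J' s - J s) * (log 2 (path_prob n (ff_kernel n J) s) +
      2 * \<kappa> * max 0 (mean_distortion n d J - D) * d (fst s) (snd s)))"
proof -
  let ?S = "blocks n \<times> blocks n :: ('x list \<times> 'y list) set"
  define F where "F = (\<lambda>t s. (1 - t) * J s + t * J' s)"
  define p where "p = (\<lambda>t. path_prob n (ff_kernel n (F t)))"
  define e where "e = (\<lambda>t. mean_distortion n d (F t))"
  define a where "a = (\<lambda>t. max 0 (e t - D))"
  have F0: "F 0 = J" by (simp add: F_def)
  have F_in: "F t \<in> couplings n P" if "0 < t" "t < 1" for t
    unfolding F_def by (rule couplings_mix[OF J J']) (use that in auto)
  have e: "e t = (1 - t) * mean_distortion n d J + t * mean_distortion n d J'" for t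
    unfolding e_def F_def by (rule mean_distortion_mix)
  \<comment> \<open>The kernel of the moved point \<open>F t\<close> is used at both ends of the
    segment: it is exact at \<open>F t\<close>, and Gibbs gives an inequality at \<open>J\<close>.
    The increment is thus linear with coefficients from \<open>p t\<close>; only afterwards does
    \<open>t\<close> tend to 0.\<close>
  have step: "0 \<le> (\<Sum>s\<in>?S. (J' s - J s) * (log 2 (p t s) + 2 * \<kappa> * a t * d (fst s) (snd s)))"
    if t: "0 < t" "t < 1" for t
  proof -
    have Fpos: "0 < F t s" if "s \<in> ?S" "0 < J s" for s
      using that t couplingsD(1)[OF J', of s] unfolding F_def by (intro add_pos_nonneg mult_pos_pos) auto
    have "(\<Sum>s\<in>?S. J s * log 2 (p t s)) \<le> ff_info n J"
      unfolding p_def using couplingsD(2)[OF F_in[OF t]] Fpos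
      by (intro gibbs_ff_info[OF couplingsD(2)[OF J]] is_kernel_ff_kernel path_prob_ff_kernel_pos)
    moreover have "ff_info n (F t) = (\<Sum>s\<in>?S. F t s * log 2 (p t s))"
      by (simp add: ff_info_def p_def)
    moreover have "(\<Sum>s\<in>?S. F t s * log 2 (p t s)) - (\<Sum>s\<in>?S. J s * log 2 (p t s)) =
        t * (\<Sum>s\<in>?S. (J' s - J s) * log 2 (p t s))"
      by (simp add: F_def sum_distrib_left algebra_simps flip: sum_subtractf)
    ultimately have info: "ff_info n (F t) - ff_info n J \<le> t * (\<Sum>s\<in>?S. (J' s - J s) * log 2 (p t s))"
      by linarith
    have a0: "a 0 = max 0 (mean_distortion n d J - D)"
      by (simp add: a_def e_def F0)
    \<comment> \<open>Tangent inequality for the square, taken at \<open>a t\<close>. The next step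
      is trivial if \<open>a t = 0\<close>; otherwise \<open>a t = e t - D\<close>, while
      \<open>a 0 \<ge> e 0 - D\<close>.\<close>
    have "(a t)\<^sup>2 - (a 0)\<^sup>2 \<le> 2 * a t * (a t - a 0)"
      using zero_le_power2[of "a t - a 0"] by (simp add: power2_eq_square algebra_simps)
    also have "\<dots> \<le> 2 * a t * (e t - e 0)"
      by (cases "a t = 0") (auto simp: a_def intro!: mult_left_mono)
    also have "e t - e 0 = t * (\<Sum>s\<in>?S. (J' s - J s) * d (fst s) (snd s))"
      unfolding e by (simp add: mean_distortion_def algebra_simps sum_subtractf)
    finally have "\<kappa> * ((a t)\<^sup>2 - (a 0)\<^sup>2) \<le>
        \<kappa> * (2 * a t * (t * (\<Sum>s\<in>?S. (J' s - J s) * d (fst s) (snd s))))"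
      using \<kappa> by (rule mult_left_mono)
    moreover have "ff_info n J + \<kappa> * (a 0)\<^sup>2 \<le> ff_info n (F t) + \<kappa> * (a t)\<^sup>2"
      using min[OF t] unfolding \<Phi>_def a0 unfolding F_def a_def e_def .
    ultimately have "0 \<le> t * (\<Sum>s\<in>?S. (J' s - J s) * log 2 (p t s)) +
        \<kappa> * (2 * a t * (t * (\<Sum>s\<in>?S. (J' s - J s) * d (fst s) (snd s))))"
      using info unfolding right_diff_distrib by linarith
    also have "\<dots> = t * (\<Sum>s\<in>?S. (J' s - J s) * (log 2 (p t s) + 2 * \<kappa> * a t * d (fst s) (snd s)))"
      by (simp add: algebra_simps sum_distrib_left sum.distrib sum_subtractf)
    finally show ?thesis using t by (simp add: zero_le_mult_iff)
  qed
  have lim_F: "((\<lambda>t. F t s) \<longlongrightarrow> J s) (at_right 0)" for s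
    unfolding F_def by (auto intro!: tendsto_eq_intros)
  have "((\<lambda>t. (J' s - J s) * (log 2 (p t s) + 2 * \<kappa> * a t * d (fst s) (snd s))) \<longlongrightarrow>
      (J' s - J s) * (log 2 (p 0 s) + 2 * \<kappa> * a 0 * d (fst s) (snd s))) (at_right 0)" if s: "s \<in> ?S" for s
  \<comment> \<open>Over a null source block both couplings vanish, so a possible jump of the kernel
    there is multiplied by 0.\<close>
  proof (cases "pmf P (fst s) = 0")
    case True
    then have "J s = 0" "J' s = 0"
      using couplings_le[OF J s] couplings_le[OF J' s] couplingsD(1)[OF J, of s] couplingsD(1)[OF J', of s]
      by auto
    then show ?thesis by simp
  next
    case False
    then have Js: "0 < J s" using pos[OF s] by (simp add: less_le)
    have "\<forall>\<^sub>F t in at_right 0. \<forall>s\<in>?S. 0 \<le> F t s"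
      using couplingsD(2)[OF F_in] by (auto simp: eventually_at_right_field intro!: exI[of _ 1])
    then have "((\<lambda>t. p t s) \<longlongrightarrow> p 0 s) (at_right 0)"
      unfolding p_def F0 by (rule tendsto_path_prob_ff_kernel[OF lim_F _ couplingsD(2)[OF J] s Js])
    moreover have "0 < p 0 s"
      unfolding p_def F0 by (rule path_prob_ff_kernel_pos[OF couplingsD(2)[OF J] s Js])
    moreover have "(e \<longlongrightarrow> e 0) (at_right 0)"
      unfolding e by (auto intro!: tendsto_eq_intros)
    then have "(a \<longlongrightarrow> a 0) (at_right 0)"
      unfolding a_def by (intro tendsto_max tendsto_const tendsto_diff)
    ultimately show ?thesis by (intro tendsto_intros) auto
  qed
  then have "((\<lambda>t. \<Sum>s\<in>?S. (J' s - J s) * (log 2 (p t s) + 2 * \<kappa> * a t * d (fst s) (snd s))) \<longlongrightarrow>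
      (\<Sum>s\<in>?S. (J' s - J s) * (log 2 (p 0 s) + 2 * \<kappa> * a 0 * d (fst s) (snd s)))) (at_right 0)"
    by (rule tendsto_sum)
  moreover have "\<forall>\<^sub>F t in at_right 0.
      0 \<le> (\<Sum>s\<in>?S. (J' s - J s) * (log 2 (p t s) + 2 * \<kappa> * a t * d (fst s) (snd s)))"
    using step by (auto simp: eventually_at_right_field intro!: exI[of _ 1])
  ultimately have "0 \<le> (\<Sum>s\<in>?S. (J' s - J s) * (log 2 (p 0 s) + 2 * \<kappa> * a 0 * d (fst s) (snd s)))"
    by (rule tendsto_lowerbound) simp
  then show ?thesis by (simp add: p_def a_def e_def F0)
qed

lemma log_path_prob_nonpos:
  assumes "is_kernel n q" "s \<in> blocks n \<times> blocks n"
  shows "log 2 (path_prob n q s) \<le> 0"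
  using path_prob_nonneg[OF assms] path_prob_le_1[OF assms]
  by (cases "path_prob n q s = 0") (auto simp: log_def less_le intro!: divide_nonpos_pos)

lemma ff_info_nonpos:
  fixes J :: "'x::finite list \<times> 'y::finite list \<Rightarrow> real"
  assumes "J \<in> couplings n P"
  shows "ff_info n J \<le> 0"
  unfolding ff_info_def
  using couplingsD(1)[OF assms] log_path_prob_nonpos[OF is_kernel_ff_kernel[OF couplingsD(2)[OF assms]]]
  by (intro sum_nonpos mult_nonneg_nonpos) auto

text \<open>By the first-order condition, the penalised minimiser \<open>J\<close> over
  \<open>K\<close> also minimises the linear functional with coefficients \<open>h\<close>, whose
  value at \<open>J\<close> is \<open>ff_info\<close> plus \<open>l\<close> times the mean
  distortion. Comparison with the pointwise minimiser of \<open>h\<close>, lifted to the floor,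
  bounds this by the dual value up to the factor \<open>1 - \<epsilon>\<close> and an error
  \<open>\<epsilon> * l * M\<close> with \<open>l \<le> 2 * \<kappa> * M\<close>. The last
  conclusion limits how far \<open>J\<close> violates the distortion constraint.\<close>

lemma near_optimal_dual:
  fixes P :: "'x::finite list pmf" and d :: "'x list \<Rightarrow> 'y::finite list \<Rightarrow> real"
  assumes d0: "\<And>x y. x \<in> blocks n \<Longrightarrow> y \<in> blocks n \<Longrightarrow> 0 \<le> d x y"
    and dM: "\<And>x y. x \<in> blocks n \<Longrightarrow> y \<in> blocks n \<Longrightarrow> d x y \<le> M"
    and M: "0 \<le> M" and \<kappa>: "0 \<le> \<kappa>" and \<epsilon>: "0 < \<epsilon>" "\<epsilon> < 1"
    and J0: "J0 \<in> couplings n P" "mean_distortion n d J0 \<le> D"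
  obtains J l \<gamma> q where "J \<in> couplings n P" "gp_feasible n P d l \<gamma> q"
    "ff_info n J - 2 * \<epsilon> * \<kappa> * M\<^sup>2 \<le>
      (1 - \<epsilon>) * (- l * D + (\<Sum>x\<in>blocks n. pmf P x * log 2 (\<gamma> x)) - source_entropy n P)"
    "ff_info n J + \<kappa> * (max 0 (mean_distortion n d J - D))\<^sup>2 \<le> \<kappa> * (\<epsilon> * M)\<^sup>2"
proof -
  let ?S = "blocks n \<times> blocks n :: ('x list \<times> 'y list) set"
  let ?U = "uniform_coupling n P :: 'x list \<times> 'y list \<Rightarrow> real"
  define \<Phi> where "\<Phi> = (\<lambda>J. ff_info n J + \<kappa> * (max 0 (mean_distortion n d J - D))\<^sup>2)"
  define K where "K = couplings n P \<inter> {J. \<forall>s\<in>?S. \<epsilon> * ?U s \<le> J s}"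
  have D0: "0 \<le> D" using mean_distortion_nonneg[OF J0(1) d0] J0(2) by force
  have U_in: "?U \<in> couplings n P" by (rule uniform_coupling_in)
  have U0: "0 \<le> ?U s" for s by (rule couplingsD(1)[OF U_in])
  have "closed {J. \<forall>s\<in>?S. \<epsilon> * ?U s \<le> J s}"
    unfolding Ball_def
    by (intro closed_Collect_all closed_Collect_imp open_Collect_const closed_Collect_le
        continuous_on_component continuous_on_const)
  then have "compact K" unfolding K_def by (intro compact_Int_closed compact_couplings)
  moreover have mix: "(\<lambda>s. (1 - \<epsilon>) * J s + \<epsilon> * ?U s) \<in> K" if "J \<in> couplings n P" for J
    using couplings_mix[OF that U_in, of \<epsilon>] couplingsD(1)[OF that] \<epsilon> by (simp add: K_def)
  then have "K \<noteq> {}" using J0(1) by blast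
  moreover have "continuous_on K \<Phi>"
    unfolding \<Phi>_def K_def
    by (intro continuous_intros continuous_on_mean_distortion continuous_on_subset[OF continuous_on_ff_info]) auto
  ultimately obtain J where JK: "J \<in> K" and min: "\<And>J'. J' \<in> K \<Longrightarrow> \<Phi> J \<le> \<Phi> J'"
    using continuous_attains_inf by metis
  have J: "J \<in> couplings n P" using JK by (simp add: K_def)
  define l where "l = 2 * \<kappa> * max 0 (mean_distortion n d J - D)"
  define h where "h = (\<lambda>s. log 2 (path_prob n (ff_kernel n J) s) + l * d (fst s) (snd s))"
  have q: "is_kernel n (ff_kernel n J)" by (rule is_kernel_ff_kernel[OF couplingsD(2)[OF J]])
  have l0: "0 \<le> l" using \<kappa> by (simp add: l_def)
  have lM: "l \<le> 2 * \<kappa> * M"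
  proof -
    have "mean_distortion n d J \<le> M" by (rule mean_distortion_le[OF J dM M])
    then have "max 0 (mean_distortion n d J - D) \<le> M" using D0 M by simp
    then show ?thesis unfolding l_def using \<kappa> by (intro mult_left_mono) auto
  qed
  have posJ: "0 < J s" if s: "s \<in> ?S" and p: "0 < pmf P (fst s)" for s
  proof -
    have "0 < \<epsilon> * ?U s" using p \<epsilon> card_blocks_pos[where 'a='y, of n] by (simp add: uniform_coupling_def)
    then show ?thesis using JK s by (fastforce simp: K_def)
  qed
  have "\<forall>x. \<exists>y. y \<in> blocks n \<and> (\<forall>z\<in>blocks n. h (x, y) \<le> h (x, z))"
  proof
    fix x
    have "arg_min_on (\<lambda>y. h (x, y)) (blocks n) \<in> blocks n"
      by (rule arg_min_if_finite(1)) simp_all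
    moreover have "\<forall>z\<in>blocks n. h (x, arg_min_on (\<lambda>y. h (x, y)) (blocks n)) \<le> h (x, z)"
      by (intro ballI arg_min_least[where f = "\<lambda>y. h (x, y)"]) simp_all
    ultimately show "\<exists>y. y \<in> blocks n \<and> (\<forall>z\<in>blocks n. h (x, y) \<le> h (x, z))" by blast
  qed
  then obtain ym where ym: "\<And>x. ym x \<in> blocks n" "\<And>x z. z \<in> blocks n \<Longrightarrow> h (x, ym x) \<le> h (x, z)"
    by metis
  \<comment> \<open>The least value of \<open>h\<close> given \<open>x\<close>. Solving
    \<open>pmf P x * \<gamma> x = 2 powr m x\<close> makes the dual constraint tight at
    \<open>ym x\<close>; null blocks have no weight in the objective, so any positive value serves
    there.\<close>
  define m where "m = (\<lambda>x. h (x, ym x))"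
  define \<gamma> where "\<gamma> = (\<lambda>x. if pmf P x = 0 then 1 else 2 powr (m x - log 2 (pmf P x)))"
  have feas: "gp_feasible n P d l \<gamma> (ff_kernel n J)"
    unfolding gp_feasible_iff
  proof (intro conjI ballI)
    fix x :: "'x list" and y :: "'y list" assume x: "x \<in> blocks n" and y: "y \<in> blocks n"
    show "pmf P x * \<gamma> x \<le> 2 powr (l * d x y) * path_prob n (ff_kernel n J) (x, y)"
    proof (cases "pmf P x = 0")
      case True
      then show ?thesis using path_prob_nonneg[OF q, of "(x, y)"] x y by simp
    next
      case False
      then have px: "0 < pmf P x" by (simp add: less_le)
      have "0 < J (x, y)" using posJ[of "(x, y)"] px x y by simp
      then have pp: "0 < path_prob n (ff_kernel n J) (x, y)"
        using path_prob_ff_kernel_pos[OF couplingsD(2)[OF J]] x y by simp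
      have "pmf P x * \<gamma> x = 2 powr m x"
        using px False by (simp add: \<gamma>_def powr_diff)
      also have "\<dots> \<le> 2 powr h (x, y)"
        using ym(2)[OF y] by (simp add: m_def)
      also have "\<dots> = 2 powr (l * d x y) * path_prob n (ff_kernel n J) (x, y)"
        using pp by (simp add: h_def powr_add)
      finally show ?thesis .
    qed
  qed (use l0 q in \<open>auto simp: \<gamma>_def\<close>)
  \<comment> \<open>All mass of \<open>x\<close> is sent to \<open>ym x\<close>, which minimises the
    linear functional over all couplings; mixing with the uniform coupling (\<open>J1\<close>)
    brings it into \<open>K\<close>.\<close>
  define Jm where "Jm = (\<lambda>s. if snd s = ym (fst s) then pmf P (fst s) else 0)"
  have Jm: "Jm \<in> couplings n P"
    using ym(1) by (auto simp: couplings_def Jm_def pmf_le_1)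
  define A where "A = (\<Sum>x\<in>blocks n. pmf P x * m x)"
  have A: "(\<Sum>s\<in>?S. Jm s * h s) = A"
  proof -
    have "(\<Sum>s\<in>?S. Jm s * h s) = (\<Sum>s\<in>?S. Jm s * m (fst s))"
      by (rule sum.cong) (auto simp: Jm_def m_def)
    then show ?thesis unfolding A_def sum_couplings_fst[OF Jm] .
  qed
  have "(\<Sum>x\<in>blocks n. pmf P x * log 2 (\<gamma> x)) = (\<Sum>x\<in>blocks n. pmf P x * m x - pmf P x * log 2 (pmf P x))"
    by (rule sum.cong) (auto simp: \<gamma>_def right_diff_distrib)
  then have obj: "(\<Sum>x\<in>blocks n. pmf P x * log 2 (\<gamma> x)) - source_entropy n P = A"
    by (simp add: sum_subtractf A_def source_entropy_def)
  define J1 where "J1 = (\<lambda>s. (1 - \<epsilon>) * Jm s + \<epsilon> * ?U s)"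
  have J1K: "J1 \<in> K" unfolding J1_def by (rule mix[OF Jm])
  then have J1: "J1 \<in> couplings n P" by (simp add: K_def)
  have "0 \<le> (\<Sum>s\<in>?S. (J1 s - J s) * (log 2 (path_prob n (ff_kernel n J) s) +
      2 * \<kappa> * max 0 (mean_distortion n d J - D) * d (fst s) (snd s)))"
  proof (rule penalised_first_order[OF J J1 posJ \<kappa>])
    fix t :: real assume t: "0 < t" "t < 1"
    have "(\<lambda>s. (1 - t) * J s + t * J1 s) \<in> K"
      unfolding K_def
    proof (intro IntI CollectI ballI)
      show "(\<lambda>s. (1 - t) * J s + t * J1 s) \<in> couplings n P"
        using t by (intro couplings_mix[OF J J1]) auto
      fix s assume "s \<in> ?S"
      then have "\<epsilon> * ?U s \<le> J s" "\<epsilon> * ?U s \<le> J1 s" using JK J1K by (auto simp: K_def)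
      then have "(1 - t) * (\<epsilon> * ?U s) + t * (\<epsilon> * ?U s) \<le> (1 - t) * J s + t * J1 s"
        using t by (intro add_mono mult_left_mono) auto
      then show "\<epsilon> * ?U s \<le> (1 - t) * J s + t * J1 s" by (simp add: algebra_simps)
    qed
    from min[OF this] show "ff_info n J + \<kappa> * (max 0 (mean_distortion n d J - D))\<^sup>2 \<le>
        ff_info n (\<lambda>s. (1 - t) * J s + t * J1 s) +
        \<kappa> * (max 0 (mean_distortion n d (\<lambda>s. (1 - t) * J s + t * J1 s) - D))\<^sup>2"
      by (simp add: \<Phi>_def)
  qed
  then have "(\<Sum>s\<in>?S. J s * h s) \<le> (\<Sum>s\<in>?S. J1 s * h s)"
    by (simp add: h_def l_def left_diff_distrib sum_subtractf)
  also have "\<dots> = (1 - \<epsilon>) * A + \<epsilon> * (\<Sum>s\<in>?S. ?U s * h s)"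
    unfolding A[symmetric] by (simp add: J1_def algebra_simps sum.distrib sum_distrib_left sum_subtractf)
  also have "(\<Sum>s\<in>?S. ?U s * h s) \<le> (\<Sum>s\<in>?S. ?U s * (l * M))"
  proof (intro sum_mono mult_left_mono U0)
    fix s assume s: "s \<in> ?S"
    have "l * d (fst s) (snd s) \<le> l * M" using s l0 by (auto intro!: mult_left_mono dM)
    then show "h s \<le> l * M" using log_path_prob_nonpos[OF q s] by (simp add: h_def)
  qed
  also have "\<dots> \<le> 1 * (l * M)"
    unfolding sum_distrib_right[symmetric]
    by (intro mult_right_mono sum_couplings_le_1[OF U_in]) (use l0 M in auto)
  finally have upper: "(\<Sum>s\<in>?S. J s * h s) \<le> (1 - \<epsilon>) * A + \<epsilon> * (l * M)"
    using \<epsilon> by (simp add: mult_left_mono)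
  have sumJ: "(\<Sum>s\<in>?S. J s * h s) = ff_info n J + l * mean_distortion n d J"
    by (simp add: h_def ff_info_def mean_distortion_def sum.distrib sum_distrib_left algebra_simps)
  \<comment> \<open>Complementary slackness in one direction: \<open>l\<close> is 0 unless the mean
    distortion exceeds \<open>D\<close>.\<close>
  have compl: "l * D \<le> l * mean_distortion n d J"
    using \<kappa> by (cases "mean_distortion n d J \<le> D") (auto simp: l_def intro!: mult_left_mono)
  have "\<epsilon> * (l * M) \<le> \<epsilon> * ((2 * \<kappa> * M) * M)"
    using \<epsilon> M lM by (intro mult_left_mono mult_right_mono) auto
  \<comment> \<open>Allows the factor \<open>1 - \<epsilon>\<close> to be put on
    \<open>- l * D\<close> as well; \<open>D\<close> is nonnegative because \<open>J0\<close>
    satisfies the constraint.\<close>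
  moreover have "0 \<le> \<epsilon> * (l * D)" using \<epsilon> l0 D0 by simp
  ultimately have bound: "ff_info n J - 2 * \<epsilon> * \<kappa> * M\<^sup>2 \<le> (1 - \<epsilon>) * (- l * D + A)"
    using upper sumJ compl by (simp add: algebra_simps power2_eq_square)
  have penalty: "ff_info n J + \<kappa> * (max 0 (mean_distortion n d J - D))\<^sup>2 \<le> \<kappa> * (\<epsilon> * M)\<^sup>2"
  proof -
    \<comment> \<open>The competitor is \<open>J0\<close> lifted to the floor. It exceeds
      \<open>D\<close> by at most \<open>\<epsilon> * M\<close>, and its \<open>ff_info\<close> is
      at most 0.\<close>
    let ?J = "\<lambda>s. (1 - \<epsilon>) * J0 s + \<epsilon> * ?U s"
    have "mean_distortion n d ?J \<le> 1 * D + \<epsilon> * M"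
      unfolding mean_distortion_mix
    proof (rule add_mono)
      show "(1 - \<epsilon>) * mean_distortion n d J0 \<le> 1 * D"
        using J0(2) \<epsilon> mean_distortion_nonneg[OF J0(1) d0] by (intro mult_mono) auto
      have "mean_distortion n d ?U \<le> M" by (rule mean_distortion_le[OF U_in dM M])
      then show "\<epsilon> * mean_distortion n d ?U \<le> \<epsilon> * M"
        using \<epsilon> by (intro mult_left_mono) auto
    qed
    then have "(max 0 (mean_distortion n d ?J - D))\<^sup>2 \<le> (\<epsilon> * M)\<^sup>2"
      using \<epsilon> M by (intro power_mono) auto
    then have "\<kappa> * (max 0 (mean_distortion n d ?J - D))\<^sup>2 \<le> \<kappa> * (\<epsilon> * M)\<^sup>2"
      using \<kappa> by (rule mult_left_mono)
    then show ?thesis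
      using min[OF mix[OF J0(1)]] ff_info_nonpos[of ?J n P] mix[OF J0(1)] by (simp add: \<Phi>_def K_def)
  qed
  show ?thesis
  proof (rule that[OF J feas _ penalty])
    have A_eq: "- l * D + A = - l * D + (\<Sum>x\<in>blocks n. pmf P x * log 2 (\<gamma> x)) - source_entropy n P"
      using obj by linarith
    show "ff_info n J - 2 * \<epsilon> * \<kappa> * M\<^sup>2 \<le>
        (1 - \<epsilon>) * (- l * D + (\<Sum>x\<in>blocks n. pmf P x * log 2 (\<gamma> x)) - source_entropy n P)"
      using bound unfolding A_eq .
  qed
qed

subsection \<open>Channels and directed information\<close>

lemma pmf_joint_pmf: "pmf (joint_pmf P W) (x, y) = pmf P x * pmf (W x) y"
proof -
  have "pmf (map_pmf (Pair x') (W x')) (x, y) = pmf (W x) y * indicator {x} x'" for x'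
    by (cases "x' = x") (auto simp: pmf_map_inj' inj_def intro!: pmf_map_outside)
  then show ?thesis
    unfolding joint_pmf_def pmf_bind by (simp add: measure_pmf_single)
qed

lemma joint_pmf_in_couplings:
  assumes "W \<in> channels n"
  shows "pmf (joint_pmf P W) \<in> couplings n P"
proof -
  have "(\<Sum>y\<in>blocks n. pmf (W x) y) = 1" if "x \<in> blocks n" for x
    using assms that by (intro sum_pmf_eq_1) (auto simp: channels_def)
  then show ?thesis
    by (simp add: couplings_def pmf_le_1 del: split_paired_All)
       (simp add: pmf_joint_pmf flip: sum_distrib_left)
qed

lemma set_joint_pmf:
  assumes "set_pmf P \<subseteq> blocks n" "W \<in> channels n"
  shows "set_pmf (joint_pmf P W) \<subseteq> blocks n \<times> blocks n"
  using assms by (fastforce simp: joint_pmf_def channels_def)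

lemma expected_distortion_eq:
  fixes P :: "'x::finite list pmf" and W :: "'x list \<Rightarrow> 'y::finite list pmf"
  assumes "set_pmf P \<subseteq> blocks n" "W \<in> channels n"
  shows "expected_distortion P d W = mean_distortion n d (pmf (joint_pmf P W))"
  unfolding expected_distortion_def mean_distortion_def
  by (subst integral_measure_pmf[where A = "blocks n \<times> blocks n"])
     (use set_joint_pmf[OF assms] in \<open>auto simp: case_prod_beta\<close>)

lemma coupling_channel:
  fixes J :: "'x::finite list \<times> 'y::finite list \<Rightarrow> real"
  assumes J: "J \<in> couplings n P"
  obtains W where "W \<in> channels n" "\<And>s. s \<in> blocks n \<times> blocks n \<Longrightarrow> pmf (joint_pmf P W) s = J s"
proof
  let ?f = "\<lambda>x y. if y \<in> blocks n then J (x, y) / pmf P x else 0"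
  \<comment> \<open>Disintegration of \<open>J\<close>. A row over a null source block is free; a
    point mass on some block of length \<open>n\<close> keeps \<open>W\<close> a channel.\<close>
  define W where "W = (\<lambda>x. if pmf P x = 0 then return_pmf (replicate n undefined) else embed_pmf (?f x))"
  have pmf_W: "pmf (W x) y = ?f x y" if x: "x \<in> blocks n" and p: "pmf P x \<noteq> 0" for x y
  proof -
    have nonneg: "0 \<le> ?f x y" for y using couplingsD(1)[OF J] by simp
    have "(\<integral>\<^sup>+y. ennreal (?f x y) \<partial>count_space UNIV) = (\<Sum>y\<in>blocks n. ennreal (?f x y))"
      by (rule nn_integral_count_space'[where A = "blocks n"]) (simp_all add: nonneg)
    also have "\<dots> = ennreal (\<Sum>y\<in>blocks n. ?f x y)"
      by (rule sum_ennreal) (rule nonneg)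
    also have "(\<Sum>y\<in>blocks n. ?f x y) = 1"
      using couplingsD(3)[OF J x] p by (simp flip: sum_divide_distrib)
    finally have "(\<integral>\<^sup>+y. ennreal (?f x y) \<partial>count_space UNIV) = 1" by simp
    from pmf_embed_pmf[OF nonneg this, of y] p show ?thesis by (simp add: W_def)
  qed
  show "W \<in> channels n"
    unfolding channels_def
  proof (intro CollectI ballI subsetI)
    fix x y assume x: "x \<in> blocks n" and y: "y \<in> set_pmf (W x)"
    show "y \<in> blocks n"
    proof (cases "pmf P x = 0")
      case True
      then show ?thesis using y by (simp add: W_def blocks_def)
    next
      case False
      then show ?thesis using y pmf_W[OF x False, of y] by (auto simp: set_pmf_iff split: if_splits)
    qed
  qed
  fix s :: "'x list \<times> 'y list" assume s: "s \<in> blocks n \<times> blocks n"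
  obtain x y where xy: "s = (x, y)" by (cases s)
  show "pmf (joint_pmf P W) s = J s"
  proof (cases "pmf P x = 0")
    case True
    then show ?thesis using couplings_le[OF J s] couplingsD(1)[OF J, of s] by (simp add: xy pmf_joint_pmf)
  next
    case False
    then show ?thesis using pmf_W[of x y] s by (simp add: xy pmf_joint_pmf)
  qed
qed

lemma marginal_cong:
  "(\<And>s. s \<in> blocks n \<times> blocks n \<Longrightarrow> J s = J' s) \<Longrightarrow> marginal n J u v = marginal n J' u v"
  unfolding marginal_def by (rule sum.cong) auto

lemma ff_info_cong:
  assumes "\<And>s. s \<in> blocks n \<times> blocks n \<Longrightarrow> J s = J' s"
  shows "ff_info n J = ff_info n J'"
proof -
  have "ff_kernel n J = ff_kernel n J'"
    by (intro ext) (simp add: ff_kernel_def marginal_cong[OF assms])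
  then show ?thesis unfolding ff_info_def using assms by (intro sum.cong) auto
qed

lemma mean_distortion_cong:
  "(\<And>s. s \<in> blocks n \<times> blocks n \<Longrightarrow> J s = J' s) \<Longrightarrow> mean_distortion n d J = mean_distortion n d J'"
  unfolding mean_distortion_def by (rule sum.cong) auto

lemma simple_distributed_pmf:
  assumes "finite (range F)" "finite A" "set_pmf J \<subseteq> A"
  shows "simple_distributed (measure_pmf J) F (\<lambda>c. \<Sum>w | w \<in> A \<and> F w = c. pmf J w)"
proof (rule prob_space.simple_distributedI[OF measure_pmf.prob_space_axioms])
  show "simple_function (measure_pmf J) F"
    using assms(1) by (simp add: simple_function_def)
  fix c
  have "measure (measure_pmf J) (F -` {c} \<inter> space (measure_pmf J)) = measure (measure_pmf J) {w \<in> A. F w = c}"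
    by (rule measure_pmf.finite_measure_eq_AE) (use assms(3) in \<open>auto simp: AE_measure_pmf_iff\<close>)
  also have "\<dots> = (\<Sum>w | w \<in> A \<and> F w = c. pmf J w)"
    using assms(2) by (simp add: measure_measure_pmf_finite)
  finally show "(\<Sum>w | w \<in> A \<and> F w = c. pmf J w) =
      measure (measure_pmf J) (F -` {c} \<inter> space (measure_pmf J))" ..
qed (simp add: sum_nonneg)

text \<open>The formula for simple random variables sums over value triples; regrouping the sample
  points by their triple turns it into an expectation over \<open>A\<close>, where the sums inside
  the logarithm can be matched with \<open>marginal\<close>.\<close>

lemma cond_mutual_info_eq_sum:
  fixes J :: "'w pmf"
  assumes X: "finite (range X)" and Y: "finite (range Y)" and Z: "finite (range Z)"
    and A: "finite A" "set_pmf J \<subseteq> A"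
  shows "cond_mutual_info J X Y Z = (\<Sum>w\<in>A. pmf J w * log 2
    ((\<Sum>w' | w' \<in> A \<and> X w' = X w \<and> Y w' = Y w \<and> Z w' = Z w. pmf J w') /
     ((\<Sum>w' | w' \<in> A \<and> X w' = X w \<and> Z w' = Z w. pmf J w') *
      ((\<Sum>w' | w' \<in> A \<and> Y w' = Y w \<and> Z w' = Z w. pmf J w') /
       (\<Sum>w' | w' \<in> A \<and> Z w' = Z w. pmf J w')))))"
proof -
  interpret information_space "measure_pmf J" 2
    by standard simp
  note sd = simple_distributed_pmf[OF _ A]
  have YZ: "finite (range (\<lambda>w. (Y w, Z w)))"
    by (rule finite_subset[OF _ finite_cartesian_product[OF Y Z]]) auto
  have XZ: "finite (range (\<lambda>w. (X w, Z w)))"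
    by (rule finite_subset[OF _ finite_cartesian_product[OF X Z]]) auto
  have XYZ: "finite (range (\<lambda>w. (X w, Y w, Z w)))"
    by (rule finite_subset[OF _ finite_cartesian_product[OF X YZ]]) auto
  let ?T = "\<lambda>w. (X w, Y w, Z w)"
  let ?L = "\<lambda>(x, y, z). log 2
    ((\<Sum>w | w \<in> A \<and> ?T w = (x, y, z). pmf J w) /
     ((\<Sum>w | w \<in> A \<and> (X w, Z w) = (x, z). pmf J w) *
      ((\<Sum>w | w \<in> A \<and> (Y w, Z w) = (y, z). pmf J w) / (\<Sum>w | w \<in> A \<and> Z w = z. pmf J w))))"
  have "cond_mutual_info J X Y Z = (\<Sum>t\<in>range ?T. (\<Sum>w | w \<in> A \<and> ?T w = t. pmf J w) * ?L t)"
    unfolding cond_mutual_info_def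
    using conditional_mutual_information_eq[OF sd[OF Z] sd[OF YZ] sd[OF XZ] sd[OF XYZ]]
    by (simp add: case_prod_beta prod_eq_iff)
  also have "\<dots> = (\<Sum>t\<in>range ?T. \<Sum>w | w \<in> A \<and> ?T w = t. pmf J w * ?L (?T w))"
    unfolding sum_distrib_right by (intro sum.cong refl) auto
  also have "\<dots> = (\<Sum>w\<in>A. pmf J w * ?L (?T w))"
    by (rule sum.group) (use A(1) XYZ in auto)
  finally show ?thesis by simp
qed

lemma marginal_take:
  assumes "s \<in> blocks n \<times> blocks n" "j \<le> n" "k \<le> n"
  shows "marginal n J (take j (fst s)) (take k (snd s)) = (\<Sum>w | w \<in> blocks n \<times> blocks n \<and>
    take j (fst w) = take j (fst s) \<and> take k (snd w) = take k (snd s). J w)"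
  unfolding marginal_def by (rule sum.cong) (use assms in \<open>auto simp: blocks_def\<close>)

text \<open>Each conditional mutual information is a combination of four logarithms of marginals.
  Two involve \<open>take i\<close> of the reproduction and add up to \<open>ff_info\<close>; the
  two that involve the source alone telescope to the logarithm of \<open>P\<close>.\<close>

lemma directed_info_eq:
  fixes W :: "'x::finite list \<Rightarrow> 'y::finite list pmf"
  assumes P: "set_pmf P \<subseteq> blocks n" and W: "W \<in> channels n"
  shows "directed_info n P W = ff_info n (pmf (joint_pmf P W)) + source_entropy n P"
proof -
  define J where "J = pmf (joint_pmf P W)"
  let ?S = "blocks n \<times> blocks n :: ('x list \<times> 'y list) set"
  have J: "J \<in> couplings n P" unfolding J_def by (rule joint_pmf_in_couplings[OF W])
  let ?m = "\<lambda>s i k. marginal n J (take i (fst s)) (take k (snd s))"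
  have finite_take: "finite (range (\<lambda>s. take k (f s)))" for f :: "'x list \<times> 'y list \<Rightarrow> 'c::finite list" and k
    by (rule finite_subset[OF _ finite_lists_length_le[OF finite_class.finite_UNIV, of k]]) auto
  have cmi: "cond_mutual_info (joint_pmf P W) (\<lambda>(x, y). take i y) (\<lambda>(x, y). x ! (i - 1)) (\<lambda>(x, y). take (i - 1) x)
      = (\<Sum>s\<in>?S. (J s * log 2 (?m s i i) - J s * log 2 (?m s (i - 1) i)) -
          (J s * log 2 (?m s i 0) - J s * log 2 (?m s (i - 1) 0)))" if i: "i \<in> {1..n}" for i
  proof -
    have i_le: "i \<le> n" using i by simp
    \<comment> \<open>The letter at list index \<open>i - 1\<close> together with the prefix before
      it is the prefix of length \<open>i\<close>.\<close>
    have nth: "take (i - 1) x = take (i - 1) x' \<and> x ! (i - 1) = x' ! (i - 1) \<longleftrightarrow> take i x = take i x'"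
      if "x \<in> blocks n" "x' \<in> blocks n" for x x' :: "'x list"
      unfolding take_pred_append_nth[OF that(1) i, symmetric] take_pred_append_nth[OF that(2) i, symmetric]
      using that i by (simp add: blocks_def)
    have "cond_mutual_info (joint_pmf P W) (\<lambda>s. take i (snd s)) (\<lambda>s. fst s ! (i - 1)) (\<lambda>s. take (i - 1) (fst s))
      = (\<Sum>s\<in>?S. J s * log 2 (?m s i i / (?m s (i - 1) i * (?m s i 0 / ?m s (i - 1) 0))))"
      unfolding cond_mutual_info_eq_sum[OF finite_take finite finite_take finite_cartesian_product[OF finite_blocks finite_blocks] set_joint_pmf[OF P W]]
    proof (rule sum.cong[OF refl], fold J_def)
      fix s :: "'x list \<times> 'y list" assume s: "s \<in> ?S"
      have nth_s: "fst w ! (i - 1) = fst s ! (i - 1) \<and> take (i - 1) (fst w) = take (i - 1) (fst s) \<longleftrightarrow>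
          take i (fst w) = take i (fst s)" if "w \<in> ?S" for w
        using nth[of "fst w" "fst s"] that s by auto
      note m = marginal_take[OF s]
      have "(\<Sum>w' | w' \<in> ?S \<and> take i (snd w') = take i (snd s) \<and> fst w' ! (i - 1) = fst s ! (i - 1) \<and>
          take (i - 1) (fst w') = take (i - 1) (fst s). J w') = ?m s i i"
        unfolding m[OF i_le i_le] by (intro sum.cong Collect_cong refl) (use nth_s in blast)
      moreover have "(\<Sum>w' | w' \<in> ?S \<and> take i (snd w') = take i (snd s) \<and>
          take (i - 1) (fst w') = take (i - 1) (fst s). J w') = ?m s (i - 1) i"
        using i by (subst marginal_take[OF s]) (auto intro!: sum.cong)
      moreover have "(\<Sum>w' | w' \<in> ?S \<and> fst w' ! (i - 1) = fst s ! (i - 1) \<and>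
          take (i - 1) (fst w') = take (i - 1) (fst s). J w') = ?m s i 0"
        unfolding m[OF i_le le0] unfolding take_0 by (intro sum.cong Collect_cong refl) (use nth_s in blast)
      moreover have "(\<Sum>w' | w' \<in> ?S \<and> take (i - 1) (fst w') = take (i - 1) (fst s). J w') = ?m s (i - 1) 0"
        using i by (subst marginal_take[OF s]) (auto intro!: sum.cong)
      ultimately show "J s * log 2
        ((\<Sum>w' | w' \<in> ?S \<and> take i (snd w') = take i (snd s) \<and> fst w' ! (i - 1) = fst s ! (i - 1) \<and>
          take (i - 1) (fst w') = take (i - 1) (fst s). J w') /
        ((\<Sum>w' | w' \<in> ?S \<and> take i (snd w') = take i (snd s) \<and>
          take (i - 1) (fst w') = take (i - 1) (fst s). J w') *
        ((\<Sum>w' | w' \<in> ?S \<and> fst w' ! (i - 1) = fst s ! (i - 1) \<and>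
          take (i - 1) (fst w') = take (i - 1) (fst s). J w') /
        (\<Sum>w' | w' \<in> ?S \<and> take (i - 1) (fst w') = take (i - 1) (fst s). J w')))) =
        J s * log 2 (?m s i i / (?m s (i - 1) i * (?m s i 0 / ?m s (i - 1) 0)))"
        by (simp only:)
    qed
    also have "\<dots> = (\<Sum>s\<in>?S. (J s * log 2 (?m s i i) - J s * log 2 (?m s (i - 1) i)) -
          (J s * log 2 (?m s i 0) - J s * log 2 (?m s (i - 1) 0)))"
    proof (rule sum.cong[OF refl])
      fix s assume s: "s \<in> ?S"
      show "J s * log 2 (?m s i i / (?m s (i - 1) i * (?m s i 0 / ?m s (i - 1) 0))) =
        (J s * log 2 (?m s i i) - J s * log 2 (?m s (i - 1) i)) -
          (J s * log 2 (?m s i 0) - J s * log 2 (?m s (i - 1) 0))"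
      proof (cases "J s = 0")
        case False
        then have "0 < J s" using couplingsD(1)[OF J, of s] by linarith
        then have m: "0 < ?m s j k" if "j \<le> n" "k \<le> n" for j k
          using le_marginal_take[OF couplingsD(2)[OF J] s that] by linarith
        have "0 < ?m s i i" "0 < ?m s (i - 1) i" "0 < ?m s i 0" "0 < ?m s (i - 1) 0"
          by (intro m i_le le0 order_trans[OF diff_le_self i_le])+
        then show ?thesis
          by (simp add: log_divide_pos log_mult_pos algebra_simps del: take_0)
      qed simp
    qed
    finally show ?thesis unfolding case_prod_unfold .
  qed
  \<comment> \<open>The ends of the telescope are the total mass 1, whose logarithm is 0, and the
    source probability of the whole block.\<close>
  have tele: "(\<Sum>i=1..n. J s * log 2 (?m s i 0) - J s * log 2 (?m s (i - 1) 0)) = J s * log 2 (pmf P (fst s))"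
    if s: "s \<in> ?S" for s
  proof -
    have "?m s n 0 = (\<Sum>w\<in>{fst s} \<times> blocks n. J w)"
      unfolding marginal_def by (rule sum.cong) (use s in \<open>auto simp: blocks_def\<close>)
    also have "\<dots> = pmf P (fst s)"
      using couplingsD(3)[OF J, of "fst s"] s by (auto simp: sum.cartesian_product')
    finally have "?m s n 0 = pmf P (fst s)" .
    moreover have "?m s 0 0 = 1"
      using sum_couplings_fst[OF J, of "\<lambda>_. 1"] sum_pmf_eq_1[OF finite_blocks P] by (simp add: marginal_def)
    ultimately show ?thesis
      using sum_telescope''[of 0 n "\<lambda>i. J s * log 2 (?m s i 0)"] by simp
  qed
  have "directed_info n P W = (\<Sum>i=1..n. \<Sum>s\<in>?S. (J s * log 2 (?m s i i) - J s * log 2 (?m s (i - 1) i)) -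
          (J s * log 2 (?m s i 0) - J s * log 2 (?m s (i - 1) 0)))"
    unfolding directed_info_def by (rule sum.cong[OF refl cmi])
  also have "\<dots> = (\<Sum>s\<in>?S. (\<Sum>i=1..n. J s * log 2 (?m s i i) - J s * log 2 (?m s (i - 1) i)) -
      (\<Sum>i=1..n. J s * log 2 (?m s i 0) - J s * log 2 (?m s (i - 1) 0)))"
    unfolding sum_subtractf[symmetric] by (rule sum.swap)
  also have "\<dots> = (\<Sum>s\<in>?S. (\<Sum>i=1..n. J s * log 2 (?m s i i) - J s * log 2 (?m s (i - 1) i)) -
      J s * log 2 (pmf P (fst s)))"
    by (intro sum.cong refl arg_cong2[where f = minus] tele)
  also have "\<dots> = ff_info n J + source_entropy n P"
    unfolding sum_subtractf sum_couplings_fst[OF J, of "\<lambda>x. log 2 (pmf P x)"] ff_info_eq_marginals[OF couplingsD(2)[OF J]] source_entropy_def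
    by simp
  finally show ?thesis by (simp add: J_def)
qed

subsection \<open>Strong duality\<close>

text \<open>
  As \<open>\<kappa>\<close> grows and \<open>\<epsilon> * \<kappa>\<close> vanishes, the penalised minimisers accumulate at a coupling that
  satisfies the distortion constraint, so that the dual values cannot stay below the primal minimum.
\<close>

lemma strong_duality:
  fixes P :: "'x::finite list pmf" and d :: "'x list \<Rightarrow> 'y::finite list \<Rightarrow> real"
  assumes d0: "\<And>x y. x \<in> blocks n \<Longrightarrow> y \<in> blocks n \<Longrightarrow> 0 \<le> d x y"
    and dM: "\<And>x y. x \<in> blocks n \<Longrightarrow> y \<in> blocks n \<Longrightarrow> d x y \<le> M" and M: "0 \<le> M"
    and J0: "J0 \<in> couplings n P" "mean_distortion n d J0 \<le> D"
    and min: "\<And>J :: 'x list \<times> 'y list \<Rightarrow> real. J \<in> couplings n P \<Longrightarrow> mean_distortion n d J \<le> D \<Longrightarrow>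
      r \<le> ff_info n J + source_entropy n P"
    and \<delta>: "0 < \<delta>"
  obtains l \<gamma> q where "gp_feasible n P d l \<gamma> q"
    "r - \<delta> \<le> - l * D + (\<Sum>x\<in>blocks n. pmf P x * log 2 (\<gamma> x))"
proof (rule ccontr)
  note found = that
  assume not_found: "\<not> thesis"
  have less: "- l * D + (\<Sum>x\<in>blocks n. pmf P x * log 2 (\<gamma> x)) < r - \<delta>"
    if "gp_feasible n P d l \<gamma> q" for l \<gamma> q
    using found[OF that] not_found by force
  \<comment> \<open>It only matters that \<open>\<kappa>\<close> tends to infinity while the dual
    error \<open>2 * \<epsilon> * \<kappa> * M^2\<close> vanishes; the shift by 2 keeps
    \<open>\<epsilon>\<close> below 1.\<close>
  define \<kappa> where "\<kappa> = (\<lambda>k::nat. real k + 2)"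
  define \<epsilon> where "\<epsilon> = (\<lambda>k. 1 / (\<kappa> k)\<^sup>2)"
  let ?e = "\<lambda>J. max 0 (mean_distortion n d J - D)"
  have "\<exists>J. J \<in> couplings n P \<and>
      ff_info n J - 2 * \<epsilon> k * \<kappa> k * M\<^sup>2 \<le> (1 - \<epsilon> k) * (r - \<delta> - source_entropy n P) \<and>
      ff_info n J + \<kappa> k * (?e J)\<^sup>2 \<le> \<kappa> k * (\<epsilon> k * M)\<^sup>2" for k
  proof -
    have \<kappa>: "1 < \<kappa> k" by (simp add: \<kappa>_def)
    then have \<epsilon>: "0 < \<epsilon> k" "\<epsilon> k < 1" by (auto simp: \<epsilon>_def one_less_power)
    obtain J l \<gamma> q where J: "J \<in> couplings n P" "gp_feasible n P d l \<gamma> q"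
      "ff_info n J - 2 * \<epsilon> k * \<kappa> k * M\<^sup>2 \<le>
        (1 - \<epsilon> k) * (- l * D + (\<Sum>x\<in>blocks n. pmf P x * log 2 (\<gamma> x)) - source_entropy n P)"
      "ff_info n J + \<kappa> k * (?e J)\<^sup>2 \<le> \<kappa> k * (\<epsilon> k * M)\<^sup>2"
      by (rule near_optimal_dual[OF d0 dM M _ \<epsilon> J0, of "\<kappa> k"]) (use \<kappa> in auto)
    note J(3)
    also have "(1 - \<epsilon> k) * (- l * D + (\<Sum>x\<in>blocks n. pmf P x * log 2 (\<gamma> x)) - source_entropy n P) \<le>
        (1 - \<epsilon> k) * (r - \<delta> - source_entropy n P)"
      using less[OF J(2)] \<epsilon> by (intro mult_left_mono) auto
    finally show ?thesis using J by blast
  qed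
  then obtain J where J: "\<And>k. J k \<in> couplings n P"
    and dual_le: "\<And>k. ff_info n (J k) - 2 * \<epsilon> k * \<kappa> k * M\<^sup>2 \<le> (1 - \<epsilon> k) * (r - \<delta> - source_entropy n P)"
    and penalty: "\<And>k. ff_info n (J k) + \<kappa> k * (?e (J k))\<^sup>2 \<le> \<kappa> k * (\<epsilon> k * M)\<^sup>2"
    by metis
  \<comment> \<open>Pairs of lists over finite alphabets are countable, so the product topology is
    first countable and compactness yields convergent subsequences.\<close>
  have "seq_compact (couplings n P :: ('x list \<times> 'y list \<Rightarrow> real) set)"
    by (rule compact_imp_seq_compact[OF compact_couplings])
  then obtain L \<sigma> where L: "L \<in> couplings n P" and \<sigma>: "strict_mono (\<sigma> :: nat \<Rightarrow> nat)"
    and lim: "(J \<circ> \<sigma>) \<longlonglongrightarrow> L"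
    using J by (elim seq_compactE[where f = J]) auto
  have lim_info: "(\<lambda>k. ff_info n (J (\<sigma> k))) \<longlonglongrightarrow> ff_info n L"
    using continuous_on_tendsto_compose[OF continuous_on_ff_info lim L] J by (simp add: o_def)
  have "(\<lambda>k. mean_distortion n d (J (\<sigma> k))) \<longlonglongrightarrow> mean_distortion n d L"
    using continuous_on_tendsto_compose[OF continuous_on_mean_distortion[where A = UNIV] lim] by (simp add: o_def)
  then have lim_e: "(\<lambda>k. (?e (J (\<sigma> k)))\<^sup>2) \<longlonglongrightarrow> (?e L)\<^sup>2"
    by (intro tendsto_intros)
  have sub: "(\<lambda>k. f (\<sigma> k)) \<longlonglongrightarrow> c" if "f \<longlonglongrightarrow> c" for f :: "nat \<Rightarrow> real" and c
    using LIMSEQ_subseq_LIMSEQ[OF that \<sigma>] by (simp add: o_def)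
  have lim_\<epsilon>: "(\<lambda>k. \<epsilon> (\<sigma> k)) \<longlonglongrightarrow> 0" "(\<lambda>k. 2 * \<epsilon> (\<sigma> k) * \<kappa> (\<sigma> k) * M\<^sup>2) \<longlonglongrightarrow> 0"
      "(\<lambda>k. 1 / \<kappa> (\<sigma> k)) \<longlonglongrightarrow> 0"
    by (rule sub; unfold \<epsilon>_def \<kappa>_def; real_asymp)+
  have "ff_info n L - 0 \<le> (1 - 0) * (r - \<delta> - source_entropy n P)"
    by (rule LIMSEQ_le[OF tendsto_diff[OF lim_info lim_\<epsilon>(2)]
        tendsto_mult[OF tendsto_diff[OF tendsto_const lim_\<epsilon>(1)] tendsto_const]]) (use dual_le in auto)
  \<comment> \<open>The penalty bound divided by \<open>\<kappa>\<close>: the values of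
    \<open>ff_info\<close> converge, hence their quotients by \<open>\<kappa>\<close>
    vanish.\<close>
  moreover have "(?e L)\<^sup>2 \<le> (0 * M)\<^sup>2 - ff_info n L * 0"
  proof (rule LIMSEQ_le[OF lim_e])
    show "(\<lambda>k. (\<epsilon> (\<sigma> k) * M)\<^sup>2 - ff_info n (J (\<sigma> k)) * (1 / \<kappa> (\<sigma> k))) \<longlonglongrightarrow> (0 * M)\<^sup>2 - ff_info n L * 0"
      by (intro tendsto_intros lim_\<epsilon> lim_info)
    have "(?e (J k))\<^sup>2 \<le> (\<epsilon> k * M)\<^sup>2 - ff_info n (J k) * (1 / \<kappa> k)" for k
    proof -
      have "0 < \<kappa> k" by (simp add: \<kappa>_def)
      then show ?thesis using penalty[of k] by (simp add: field_simps)
    qed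
    then show "\<exists>N. \<forall>k\<ge>N. (?e (J (\<sigma> k)))\<^sup>2 \<le> (\<epsilon> (\<sigma> k) * M)\<^sup>2 - ff_info n (J (\<sigma> k)) * (1 / \<kappa> (\<sigma> k))"
      by blast
  qed
  then have "mean_distortion n d L \<le> D"
    by (simp add: max_def split: if_splits)
  with min[OF L] \<delta> show False using calculation by simp
qed

text \<open>
  Under Slater's condition the multiplier is bounded, and near-optimal values bound \<open>log \<gamma>\<close> from
  both sides on the support of \<open>P\<close>; the dual variables may then be confined to a compact set.
\<close>

lemma dual_attained:
  fixes P :: "'x::finite list pmf" and d :: "'x list \<Rightarrow> 'y::finite list \<Rightarrow> real"
  assumes d0: "\<And>x y. x \<in> blocks n \<Longrightarrow> y \<in> blocks n \<Longrightarrow> 0 \<le> d x y"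
    and dM: "\<And>x y. x \<in> blocks n \<Longrightarrow> y \<in> blocks n \<Longrightarrow> d x y \<le> M" and M: "0 \<le> M"
    and P: "set_pmf P \<subseteq> blocks n"
    and J0: "J0 \<in> couplings n P" "mean_distortion n d J0 < D"
    and approx: "\<And>\<delta>. 0 < \<delta> \<Longrightarrow> \<exists>l \<gamma> q. gp_feasible n P d l \<gamma> q \<and>
      r - \<delta> \<le> - l * D + (\<Sum>x\<in>blocks n. pmf P x * log 2 (\<gamma> x))"
  obtains l \<gamma> q where "gp_feasible n P d l \<gamma> q"
    "r \<le> - l * D + (\<Sum>x\<in>blocks n. pmf P x * log 2 (\<gamma> x))"
proof -
  define V where "V = ff_info n J0 + source_entropy n P"
  define e0 where "e0 = mean_distortion n d J0"
  have e0: "0 \<le> e0" "e0 < D" using mean_distortion_nonneg[OF J0(1) d0] J0(2) by (auto simp: e0_def)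
  \<comment> \<open>Weak duality at the strictly feasible \<open>J0\<close> gives
    \<open>l * (D - e0) \<le> V - r + 1\<close> for all feasible triples of value at least
    \<open>r - 1\<close>.\<close>
  define L where "L = max 0 ((V - r + 1) / (D - e0))"
  \<comment> \<open>Upper bound for \<open>log \<gamma>\<close>: path probabilities are at most 1 in
    the constraint, and \<open>l * d \<le> L * M\<close>.\<close>
  define G1 where "G1 = L * M + (\<Sum>x\<in>blocks n. \<bar>log 2 (pmf P x)\<bar>)"
  \<comment> \<open>Lower bound: the weighted sum of the logarithms is at least
    \<open>r - 1\<close>, and the other terms contribute at most \<open>G1\<close>. Null blocks add
    \<open>1 / 0 = 0\<close> here.\<close>
  define G2 where "G2 = (\<bar>r\<bar> + 1 + G1) * (\<Sum>x\<in>blocks n. 1 / pmf P x)"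
  have L0: "0 \<le> L" by (simp add: L_def)
  have G10: "0 \<le> G1" using L0 M by (auto simp: G1_def intro!: add_nonneg_nonneg sum_nonneg)
  have G20: "0 \<le> G2" using G10 by (auto simp: G2_def intro!: mult_nonneg_nonneg sum_nonneg)
  \<comment> \<open>Points of the search space are triples of \<open>\<lambda>\<close>,
    \<open>log \<gamma>\<close> and \<open>p'\<close>. Positivity of \<open>\<gamma>\<close> would
    be an open condition, whereas its logarithm ranges over a closed box.\<close>
  let ?q = "\<lambda>p :: real \<times> ('x list \<Rightarrow> real) \<times> (nat \<times> 'x list \<times> 'y list \<times> 'x \<Rightarrow> real).
    \<lambda>i u v a. snd (snd p) (i, u, v, a)"
  let ?g = "\<lambda>p :: real \<times> ('x list \<Rightarrow> real) \<times> (nat \<times> 'x list \<times> 'y list \<times> 'x \<Rightarrow> real). fst (snd p)"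
  let ?obj = "\<lambda>p. - fst p * D + (\<Sum>x\<in>blocks n. pmf P x * ?g p x)"
  define B where "B = {0..L} \<times> {g :: 'x list \<Rightarrow> real. \<forall>x. - G2 \<le> g x \<and> g x \<le> G1} \<times>
    {Q :: nat \<times> 'x list \<times> 'y list \<times> 'x \<Rightarrow> real. \<forall>z. 0 \<le> Q z \<and> Q z \<le> 1}"
  define K where "K = B \<inter>
    {p. \<forall>i\<in>{1..n}. \<forall>u\<in>blocks (i - 1). \<forall>v\<in>blocks i. (\<Sum>a\<in>UNIV. ?q p i u v a) = 1} \<inter>
    {p. \<forall>x\<in>blocks n. \<forall>y\<in>blocks n. pmf P x * 2 powr ?g p x \<le> 2 powr (fst p * d x y) * path_prob n (?q p) (x, y)}"
  have cont_g: "continuous_on A (\<lambda>p. ?g p x)" and cont_q: "continuous_on A (\<lambda>p. ?q p i u v a)" for A x i u v a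
    by (rule continuous_on_product_then_coordinatewise, intro continuous_intros)+
  have compact_K: "compact K"
    unfolding K_def
  proof (intro compact_Int_closed)
    show "compact B" unfolding B_def by (intro compact_Times compact_box_functions compact_Icc)
    show "closed {p. \<forall>i\<in>{1..n}. \<forall>u\<in>blocks (i - 1). \<forall>v\<in>blocks i. (\<Sum>a\<in>UNIV. ?q p i u v a) = 1}"
      unfolding Ball_def
      by (intro closed_Collect_all closed_Collect_imp open_Collect_const closed_Collect_eq
          continuous_on_sum continuous_on_const cont_q)
    show "closed {p. \<forall>x\<in>blocks n. \<forall>y\<in>blocks n.
        pmf P x * 2 powr ?g p x \<le> 2 powr (fst p * d x y) * path_prob n (?q p) (x, y)}"
      unfolding Ball_def path_prob_def
      by (intro closed_Collect_all closed_Collect_imp open_Collect_const closed_Collect_le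
          continuous_on_mult continuous_on_prod continuous_on_const cont_q cont_g continuous_on_powr
          continuous_on_fst continuous_on_id) auto
  qed
  have cont_obj: "continuous_on K ?obj"
    by (intro continuous_on_add continuous_on_mult continuous_on_minus continuous_on_sum
        continuous_on_const cont_g continuous_on_fst continuous_on_id)
  have K_feasible: "gp_feasible n P d (fst p) (\<lambda>x. 2 powr ?g p x) (?q p)" if "p \<in> K" for p
    using that by (auto simp: gp_feasible_iff K_def B_def is_kernel_def)
  have in_K: "\<exists>p\<in>K. r - \<delta> \<le> ?obj p" if \<delta>: "0 < \<delta>" "\<delta> \<le> 1" for \<delta>
  proof -
    obtain l \<gamma> q where feas: "gp_feasible n P d l \<gamma> q"
      and obj: "r - \<delta> \<le> - l * D + (\<Sum>x\<in>blocks n. pmf P x * log 2 (\<gamma> x))"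
      using approx[OF \<delta>(1)] by blast
    have l: "0 \<le> l" and g: "\<And>x. x \<in> blocks n \<Longrightarrow> 0 < \<gamma> x" and q: "is_kernel n q"
      and c: "\<And>x y. x \<in> blocks n \<Longrightarrow> y \<in> blocks n \<Longrightarrow>
        pmf P x * \<gamma> x \<le> 2 powr (l * d x y) * path_prob n q (x, y)"
      using feas unfolding gp_feasible_iff by auto
    have "l * (D - e0) \<le> V - r + 1"
      using weak_duality[OF feas J0(1)] obj \<delta>(2) by (simp add: V_def e0_def algebra_simps)
    then have lL: "l \<le> L" using e0 by (simp add: L_def pos_le_divide_eq le_max_iff_disj)
    \<comment> \<open>Off the support of \<open>P\<close> no bound on \<open>\<gamma>\<close> is
      available and the objective ignores it; likewise \<open>q\<close> is arbitrary outside its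
      index range. Both are reset to 0 there to fit into the box.\<close>
    define g' where "g' = (\<lambda>x. if x \<in> blocks n \<and> 0 < pmf P x then log 2 (\<gamma> x) else 0)"
    define Q where "Q = (\<lambda>(i, u, v, a). if i \<in> {1..n} \<and> u \<in> blocks (i - 1) \<and> v \<in> blocks i then q i u v a else 0)"
    have sum_g': "(\<Sum>x\<in>blocks n. pmf P x * g' x) = (\<Sum>x\<in>blocks n. pmf P x * log 2 (\<gamma> x))"
      by (rule sum.cong) (auto simp: g'_def less_le)
    have upper: "g' x \<le> G1" for x
    proof (cases "x \<in> blocks n \<and> 0 < pmf P x")
      case True
      then have x: "x \<in> blocks n" and px: "0 < pmf P x" by auto
      obtain y :: "'y list" where y: "y \<in> blocks n" using blocks_nonempty[of n] by blast
      have "pmf P x * \<gamma> x \<le> 2 powr (l * d x y) * 1"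
        using c[OF x y] path_prob_le_1[OF q, of "(x, y)"] x y
        by (elim order_trans) (auto intro: mult_left_mono)
      then have "log 2 (pmf P x * \<gamma> x) \<le> log 2 (2 powr (l * d x y))"
        using px g[OF x] by (subst log_le_cancel_iff) auto
      then have "log 2 (pmf P x) + log 2 (\<gamma> x) \<le> l * d x y"
        using px g[OF x] by (simp add: log_mult)
      moreover have "l * d x y \<le> L * M"
        using lL l d0[OF x y] dM[OF x y] L0 by (intro mult_mono) auto
      moreover have "\<bar>log 2 (pmf P x)\<bar> \<le> (\<Sum>x\<in>blocks n. \<bar>log 2 (pmf P x)\<bar>)"
        using x by (intro member_le_sum) auto
      ultimately show ?thesis using True by (simp add: g'_def G1_def)
    next
      case False
      then show ?thesis using G10 by (auto simp: g'_def)
    qed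
    have lower: "- G2 \<le> g' x" for x
    proof (cases "x \<in> blocks n \<and> 0 < pmf P x")
      case True
      then have x: "x \<in> blocks n" and px: "0 < pmf P x" by auto
      have "0 \<le> l * D" using l e0 by simp
      then have "r - 1 \<le> (\<Sum>x\<in>blocks n. pmf P x * g' x)"
        unfolding sum_g' using obj \<delta>(2) by simp
      also have "\<dots> = pmf P x * g' x + (\<Sum>z\<in>blocks n - {x}. pmf P z * g' z)"
        using x by (intro sum.remove) auto
      also have "(\<Sum>z\<in>blocks n - {x}. pmf P z * g' z) \<le> (\<Sum>z\<in>blocks n - {x}. pmf P z * G1)"
        using upper by (intro sum_mono mult_left_mono) auto
      also have "\<dots> \<le> (\<Sum>z\<in>blocks n. pmf P z * G1)"
        using G10 by (intro sum_mono2) auto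
      also have "\<dots> = G1"
        using sum_pmf_eq_1[OF finite_blocks P] by (simp flip: sum_distrib_right)
      finally have "- (\<bar>r\<bar> + 1 + G1) \<le> pmf P x * g' x" by linarith
      then have "- ((\<bar>r\<bar> + 1 + G1) * (1 / pmf P x)) \<le> g' x"
        using px by (simp add: field_simps)
      moreover have "(\<bar>r\<bar> + 1 + G1) * (1 / pmf P x) \<le> G2"
        unfolding G2_def using x G10
        by (intro mult_left_mono member_le_sum[of x "blocks n" "\<lambda>x. 1 / pmf P x"]) auto
      ultimately show ?thesis by linarith
    next
      case False
      then show ?thesis using G20 by (auto simp: g'_def)
    qed
    have path: "path_prob n (?q (l, g', Q)) s = path_prob n q s" if "s \<in> blocks n \<times> blocks n" for s
      unfolding path_prob_def
      by (rule prod.cong) (use that in \<open>auto simp: Q_def blocks_def\<close>)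
    have "0 \<le> Q z \<and> Q z \<le> 1" for z
    proof -
      obtain i u v a where z: "z = (i, u, v, a)" by (cases z)
      show ?thesis
      proof (cases "i \<in> {1..n} \<and> u \<in> blocks (i - 1) \<and> v \<in> blocks i")
        case True
        then have "\<And>a. 0 \<le> q i u v a" "(\<Sum>a\<in>UNIV. q i u v a) = 1"
          using q unfolding is_kernel_def by auto
        then show ?thesis
          using member_le_sum[of a UNIV "q i u v"] by (simp add: z Q_def)
      qed (auto simp: z Q_def)
    qed
    then have "(l, g', Q) \<in> B" using l lL upper lower by (auto simp: B_def)
    moreover have "pmf P x * 2 powr g' x \<le> 2 powr (l * d x y) * path_prob n (?q (l, g', Q)) (x, y)"
      if x: "x \<in> blocks n" and y: "y \<in> blocks n" for x y
      using c[OF x y] path[of "(x, y)"] path_prob_nonneg[OF q, of "(x, y)"] x y g[OF x]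
      by (cases "pmf P x = 0") (auto simp: g'_def less_le)
    moreover have "(\<Sum>a\<in>UNIV. Q (i, u, v, a)) = 1"
      if "i \<in> {1..n}" "u \<in> blocks (i - 1)" "v \<in> blocks i" for i u v
      using q that unfolding is_kernel_def by (simp add: Q_def)
    ultimately have "(l, g', Q) \<in> K" by (simp add: K_def)
    moreover have "r - \<delta> \<le> ?obj (l, g', Q)" using obj by (simp add: sum_g')
    ultimately show ?thesis by blast
  qed
  then have "K \<noteq> {}" using zero_less_one by blast
  from continuous_attains_sup[OF compact_K this cont_obj]
  obtain p where p: "p \<in> K" and max: "\<And>p'. p' \<in> K \<Longrightarrow> ?obj p' \<le> ?obj p" by blast
  have "r \<le> ?obj p"
  proof (rule field_le_epsilon)
    fix \<delta> :: real assume "0 < \<delta>"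
    then obtain p' where "p' \<in> K" "r - min \<delta> 1 \<le> ?obj p'" using in_K[of "min \<delta> 1"] by auto
    then show "r \<le> ?obj p + \<delta>" using max[of p'] by linarith
  qed
  then show ?thesis using that[OF K_feasible[OF p]] by simp
qed

text \<open>At the least feasible \<open>D\<close> the dual supremum need not be attained: for
  \<open>n = 1\<close>, a uniform bit and Hamming distortion with \<open>D = 0\<close>, the value 1
  would force \<open>p'\<close> to be the identity, which vanishes off the diagonal and leaves no
  positive \<open>\<gamma>\<close>. The maximum is therefore claimed under strict feasibility, and
  the supremum in general, taken in \<open>ereal\<close> so that its existence is not an
  issue.\<close>

theorem theorem3:
  fixes n :: nat
    and P :: "'x::finite list pmf"
    and d :: "'x list \<Rightarrow> 'y::finite list \<Rightarrow> real"
    and D :: real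
  assumes "1 \<le> n"
    and "set_pmf P \<subseteq> blocks n"
    and "\<And>x y. x \<in> blocks n \<Longrightarrow> y \<in> blocks n \<Longrightarrow> 0 \<le> d x y"
    and "admissible_channels n P d D \<noteq> {}"
  shows "(\<exists>W. is_arg_min (directed_info n P) (\<lambda>W. W \<in> admissible_channels n P d D) W \<and>
              ff_rate_distortion n P d D = (1 / real n) * directed_info n P W)
    \<and> ereal (ff_rate_distortion n P d D) =
        (SUP (l, \<gamma>, q) \<in> {(l, \<gamma>, q). gp_feasible n P d l \<gamma> q}. ereal (gp_objective n P D l \<gamma>))
    \<and> ((\<exists>W\<in>channels n. expected_distortion P d W < D) \<longrightarrow>
        (\<exists>l \<gamma> q. gp_feasible n P d l \<gamma> q \<and>
                 ff_rate_distortion n P d D = gp_objective n P D l \<gamma>))"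
proof -
  note n = assms(1) and P = assms(2) and d0 = assms(3)
  define M where "M = (\<Sum>x\<in>blocks n. \<Sum>y\<in>blocks n. d x y)"
  have dM: "d x y \<le> M" if "x \<in> blocks n" "y \<in> blocks n" for x y
  proof -
    have "d x y \<le> (\<Sum>y\<in>blocks n. d x y)"
      using that d0 by (intro member_le_sum) auto
    also have "\<dots> \<le> M"
      unfolding M_def using that d0
      by (intro member_le_sum[of x "blocks n" "\<lambda>x. \<Sum>y\<in>blocks n. d x y"]) (auto intro: sum_nonneg)
    finally show ?thesis .
  qed
  have M: "0 \<le> M" unfolding M_def by (intro sum_nonneg d0)
  note info_eq = directed_info_eq[OF P] and dist_eq = expected_distortion_eq[OF P]
  \<comment> \<open>The primal problem is moved to a compact set of couplings;
    \<open>coupling_channel\<close> carries the minimiser back.\<close>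
  define C where "C = couplings n P \<inter> {J. mean_distortion n d J \<le> D}"
  have C_channel: "pmf (joint_pmf P W) \<in> C" if "W \<in> admissible_channels n P d D" for W
    using that dist_eq[of W, where d = d] joint_pmf_in_couplings[of W n P] by (auto simp: C_def admissible_channels_def)
  then obtain J0 where J0: "J0 \<in> C" using assms(4) by blast
  have "compact C"
    unfolding C_def
    by (intro compact_Int_closed compact_couplings closed_Collect_le continuous_on_mean_distortion continuous_on_const)
  moreover have "continuous_on C (ff_info n)"
    unfolding C_def by (rule continuous_on_subset[OF continuous_on_ff_info]) auto
  ultimately obtain J where J: "J \<in> C" and min: "\<And>J'. J' \<in> C \<Longrightarrow> ff_info n J \<le> ff_info n J'"
    using continuous_attains_inf[of C "ff_info n"] J0 by blast
  define r where "r = ff_info n J + source_entropy n P"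
  obtain W where W: "W \<in> channels n" and WJ: "\<And>s. s \<in> blocks n \<times> blocks n \<Longrightarrow> pmf (joint_pmf P W) s = J s"
    using J by (auto simp: C_def intro: coupling_channel)
  have W_adm: "W \<in> admissible_channels n P d D"
    using W J dist_eq[OF W, where d = d] mean_distortion_cong[OF WJ, where d = d]
    by (simp add: admissible_channels_def C_def)
  have W_r: "directed_info n P W = r"
    using info_eq[OF W] ff_info_cong[OF WJ] by (simp add: r_def)
  have W_min: "r \<le> directed_info n P W'" if "W' \<in> admissible_channels n P d D" for W'
    using info_eq[of W'] min[OF C_channel[OF that]] that by (simp add: r_def admissible_channels_def)
  have rate: "ff_rate_distortion n P d D = (1 / real n) * r"
    unfolding ff_rate_distortion_def
    by (subst cInf_eq_minimum[of r]) (use W_adm W_r W_min in \<open>auto intro: rev_image_eqI\<close>)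
  have obj_eq: "gp_objective n P D l \<gamma> = (1 / real n) * (- l * D + (\<Sum>x\<in>blocks n. pmf P x * log 2 (\<gamma> x)))" for l \<gamma>
    by (simp add: gp_objective_def)
  have weak: "- l * D + (\<Sum>x\<in>blocks n. pmf P x * log 2 (\<gamma> x)) \<le> r" if "gp_feasible n P d l \<gamma> q" for l \<gamma> q
  proof -
    have "l * mean_distortion n d J \<le> l * D"
      using that J by (intro mult_left_mono) (auto simp: C_def gp_feasible_def)
    then show ?thesis using weak_duality[OF that, of J] J by (simp add: C_def r_def)
  qed
  have strong: "\<exists>l \<gamma> q. gp_feasible n P d l \<gamma> q \<and>
      r - \<delta> \<le> - l * D + (\<Sum>x\<in>blocks n. pmf P x * log 2 (\<gamma> x))" if "0 < \<delta>" for \<delta>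
  proof -
    have lower: "r \<le> ff_info n J' + source_entropy n P"
      if "J' \<in> couplings n P" "mean_distortion n d J' \<le> D" for J'
      using min[of J'] that by (simp add: r_def C_def)
    have "J0 \<in> couplings n P" "mean_distortion n d J0 \<le> D" using J0 by (auto simp: C_def)
    from strong_duality[OF d0 dM M this lower that] show ?thesis by blast
  qed
  show ?thesis
  proof (intro conjI impI)
    show "\<exists>W. is_arg_min (directed_info n P) (\<lambda>W. W \<in> admissible_channels n P d D) W \<and>
        ff_rate_distortion n P d D = (1 / real n) * directed_info n P W"
      using W_adm W_r W_min rate by (auto simp: is_arg_min_linorder intro!: exI[of _ W])
    let ?SUP = "SUP (l, \<gamma>, q) \<in> {(l, \<gamma>, q). gp_feasible n P d l \<gamma> q}. ereal (gp_objective n P D l \<gamma>)"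
    show "ereal (ff_rate_distortion n P d D) = ?SUP"
    proof (rule antisym)
      show "ereal (ff_rate_distortion n P d D) \<le> ?SUP"
      proof (rule ereal_le_epsilon2)
        fix e :: real assume e: "0 < e"
        \<comment> \<open>\<open>strong\<close> is stated without the factor
          \<open>1 / real n\<close>, so the tolerance is scaled by \<open>n\<close>.\<close>
        then have "0 < real n * e" using n by simp
        from strong[OF this] obtain l \<gamma> q where feas: "gp_feasible n P d l \<gamma> q"
          and "r - real n * e \<le> - l * D + (\<Sum>x\<in>blocks n. pmf P x * log 2 (\<gamma> x))" by blast
        then have "ff_rate_distortion n P d D \<le> gp_objective n P D l \<gamma> + e"
          unfolding rate obj_eq using n by (simp add: field_simps)
        then have "ereal (ff_rate_distortion n P d D) \<le> ereal (gp_objective n P D l \<gamma>) + ereal e" by simp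
        also have "ereal (gp_objective n P D l \<gamma>) \<le> ?SUP"
          by (rule SUP_upper2[of "(l, \<gamma>, q)"]) (use feas in auto)
        finally show "ereal (ff_rate_distortion n P d D) \<le> ?SUP + ereal e"
          by (simp add: add_right_mono)
      qed
      show "?SUP \<le> ereal (ff_rate_distortion n P d D)"
        unfolding rate obj_eq using weak n
        by (intro SUP_least) (auto simp: divide_right_mono)
    qed
    assume "\<exists>W\<in>channels n. expected_distortion P d W < D"
    then obtain W' where W': "W' \<in> channels n" "mean_distortion n d (pmf (joint_pmf P W')) < D"
      using dist_eq by fastforce
    obtain l \<gamma> q where feas: "gp_feasible n P d l \<gamma> q"
      and "r \<le> - l * D + (\<Sum>x\<in>blocks n. pmf P x * log 2 (\<gamma> x))"
      using dual_attained[OF d0 dM M P joint_pmf_in_couplings[OF W'(1)] W'(2) strong] by blast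
    then have "r = - l * D + (\<Sum>x\<in>blocks n. pmf P x * log 2 (\<gamma> x))"
      using weak[OF feas] by linarith
    then show "\<exists>l \<gamma> q. gp_feasible n P d l \<gamma> q \<and> ff_rate_distortion n P d D = gp_objective n P D l \<gamma>"
      using feas unfolding rate obj_eq by blast
  qed
qed

end
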